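(* Suppose there exist constants $\lambda,\eta>0$ such that $\lambda\|u\|^2\|v\|^2\le \frac1n\sum_{i=1}^n\langle u,A_iv\rangle^2\le \eta\|u\|^2\|v\|^2$ for all $u,v\in\mathbb{R}^p$. Let $\{x^k:k\ge0\}$ be generated by the algorithm GRNM described in the context with $\mu_2\in(0,1/2)$. Suppose that some nonzero accumulation point $\bar x$ of $\{x^k\}$ satisfies $$\Big\|\frac1n\sum_{i=1}^n\varphi_i(\bar x)A_i\Big\|\le\Big(2-\frac{8}{5-4\mu_2^2}\Big)\lambda\|\bar x\|^2 .$$ Then there are constants $c_1>0$, $c_2>0$ and $c_3\in(0,1/2)$ such that for all sufficiently large $k>K$, $$\|x^{k+1}-\bar x\|\le c_1\|x^k-\bar x\|^2+c_2\|x^k-\bar x\|^{1+\delta}+c_3\|x^k-\bar x\| .$$ If moreover $\varphi_i(\bar x)=0$ for all $i\in\{1,\dots,n\}$, then the whole sequence converges to $\bar x$ with rate $1+\delta$.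
   Context: Setting: $A_1,\dots,A_n\in\mathbb{R}^{p\times p}$ are symmetric, $x^*\in\mathbb{R}^p$, $b_i=\langle x^*,A_ix^*\rangle+\varepsilon_i$ with $\varepsilon_i\in\mathbb{R}$, $\varphi_i(x)=\langle x,A_ix\rangle-b_i$, and $f(x)=\frac1{4n}\sum_{i=1}^n\varphi_i(x)^2$, so $\nabla f(x)=\frac1n\sum_{i=1}^n\varphi_i(x)A_ix$. $\|\cdot\|$ is the Euclidean norm of vectors and the spectral norm of matrices. Write $g^k=\nabla f(x^k)$ and $H^k=\frac2n\sum_{i=1}^n A_ix^k(x^k)^\top A_i$. Algorithm GRNM (gradient regularized Newton method). Parameters: $\epsilon_G>0$, $\beta>0$, a finite integer $K_0\geq 0$, $\mu_1,\mu_2,\alpha_1,\alpha_2,\delta\in(0,1)$, and a starting point $x^0\in\mathbb{R}^p$. Set $k=0$. Phase I (gradient descent): while $\|g^k\|\ge\epsilon_G$ or $k\le K_0$, let $j_k$ be the smallest nonnegative integer with $f(x^k-\alpha_1^{j_k}g^k)\le f(x^k)-\mu_1\alpha_1^{j_k}\|g^k\|^2$, set $\tau_k=\alpha_1^{j_k}$, $x^{k+1}=x^k-\tau_kg^k$, and increase $k$ by 1. When the loop ends put $K=k$. Phase II (regularized Newton): for $k\ge K$, set $d^k=-(H^k+\beta\|g^k\|^\delta I)^{-1}g^k$, let $j_k$ be the smallest nonnegative integer with $f(x^k+\alpha_2^{j_k}d^k)\le f(x^k)+\mu_2\alpha_2^{j_k}\langle g^k,d^k\rangle$, set $\tau_k=\alpha_2^{j_k}$,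 $x^{k+1}=x^k+\tau_kd^k$, and increase $k$ by 1. Conventions: Phase II is run indefinitely (no halting), and it is assumed that $g^k\ne0$ for every finite $k$ (otherwise the algorithm stops at the stationary point $x^k$). Convergence to $\bar x$ with rate $1+\delta$ means $x^k\to\bar x$ and there is a constant $c$ with $\|x^{k+1}-\bar x\|\le c\|x^k-\bar x\|^{1+\delta}$ for all sufficiently large $k$. *)

theory Defs
  imports "HOL-Analysis.Analysis"
begin

text \<open>Since \<open>norm\<close> on \<open>real^'p^'p\<close> is the Frobenius norm, the spectral norm is the operator norm
  of the induced linear map.\<close>

definition spectral_norm :: "real^'p^'p \<Rightarrow> real" where
  "spectral_norm M = onorm (\<lambda>v. M *v v)"

definition outer :: "real^'p \<Rightarrow> real^'p \<Rightarrow> real^'p^'p" where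
  "outer x y = (\<chi> i j. x $ i * y $ j)"

definition grad :: "('a::real_inner \<Rightarrow> real) \<Rightarrow> 'a \<Rightarrow> 'a" where
  "grad f x = (THE D. GDERIV f x :> D)"

definition observation :: "(nat \<Rightarrow> real^'p^'p) \<Rightarrow> real^'p \<Rightarrow> (nat \<Rightarrow> real) \<Rightarrow> nat \<Rightarrow> real" where
  "observation A xs \<epsilon> i = xs \<bullet> (A i *v xs) + \<epsilon> i"

definition residual :: "(nat \<Rightarrow> real^'p^'p) \<Rightarrow> (nat \<Rightarrow> real) \<Rightarrow> nat \<Rightarrow> real^'p \<Rightarrow> real" where
  "residual A b i x = x \<bullet> (A i *v x) - b i"

definition objective :: "nat \<Rightarrow> (nat \<Rightarrow> real^'p^'p) \<Rightarrow> (nat \<Rightarrow> real) \<Rightarrow> real^'p \<Rightarrow> real" where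
  "objective n A b x = 1 / (4 * real n) * (\<Sum>i=1..n. (residual A b i x)\<^sup>2)"

definition gn_matrix :: "nat \<Rightarrow> (nat \<Rightarrow> real^'p^'p) \<Rightarrow> real^'p \<Rightarrow> real^'p^'p" where
  "gn_matrix n A x = (2 / real n) *\<^sub>R (\<Sum>i=1..n. A i ** outer x x ** A i)"

definition residual_matrix ::
  "nat \<Rightarrow> (nat \<Rightarrow> real^'p^'p) \<Rightarrow> (nat \<Rightarrow> real) \<Rightarrow> real^'p \<Rightarrow> real^'p^'p" where
  "residual_matrix n A b x = (1 / real n) *\<^sub>R (\<Sum>i=1..n. residual A b i x *\<^sub>R A i)"

text \<open>\<open>mat c\<close> is \<open>c\<close> times the identity matrix.\<close>

definition newton_dir ::
  "nat \<Rightarrow> (nat \<Rightarrow> real^'p^'p) \<Rightarrow> (nat \<Rightarrow> real) \<Rightarrow> real \<Rightarrow> real \<Rightarrow> real^'p \<Rightarrow> real^'p" where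
  "newton_dir n A b \<beta> \<delta> x =
     (let g = grad (objective n A b) x
      in - (matrix_inv (gn_matrix n A x + mat (\<beta> * norm g powr \<delta>)) *v g))"

text \<open>Backtracking step size at \<open>x\<close> along \<open>d\<close>, where \<open>m\<close> is the predicted slope:
  \<open>- \<parallel>g\<parallel>\<^sup>2\<close> for the gradient step, \<open>\<langle>g, d\<rangle>\<close> for the Newton step.\<close>

definition armijo_step ::
  "('a::real_vector \<Rightarrow> real) \<Rightarrow> real \<Rightarrow> real \<Rightarrow> 'a \<Rightarrow> 'a \<Rightarrow> real \<Rightarrow> real" where
  "armijo_step f \<mu> \<alpha> x d m =
     \<alpha> ^ (LEAST j::nat. f (x + \<alpha> ^ j *\<^sub>R d) \<le> f x + \<mu> * \<alpha> ^ j * m)"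

definition phase1_step :: "('a::real_inner \<Rightarrow> real) \<Rightarrow> real \<Rightarrow> real \<Rightarrow> 'a \<Rightarrow> 'a" where
  "phase1_step f \<mu> \<alpha> x =
     (let g = grad f x; \<tau> = armijo_step f \<mu> \<alpha> x (- g) (- (norm g)\<^sup>2) in x - \<tau> *\<^sub>R g)"

definition phase2_step ::
  "nat \<Rightarrow> (nat \<Rightarrow> real^'p^'p) \<Rightarrow> (nat \<Rightarrow> real) \<Rightarrow> real \<Rightarrow> real \<Rightarrow> real \<Rightarrow> real \<Rightarrow> real^'p \<Rightarrow> real^'p" where
  "phase2_step n A b \<beta> \<delta> \<mu> \<alpha> x =
     (let f = objective n A b; g = grad f x; d = newton_dir n A b \<beta> \<delta> x;
          \<tau> = armijo_step f \<mu> \<alpha> x d (g \<bullet> d)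
      in x + \<tau> *\<^sub>R d)"

definition phase1_guard ::
  "('a::real_inner \<Rightarrow> real) \<Rightarrow> real \<Rightarrow> nat \<Rightarrow> (nat \<Rightarrow> 'a) \<Rightarrow> nat \<Rightarrow> bool" where
  "phase1_guard f \<epsilon>G K0 x k \<longleftrightarrow> norm (grad f (x k)) \<ge> \<epsilon>G \<or> k \<le> K0"

text \<open>\<open>K\<close> is the index at which the while loop of the first phase is left.\<close>

definition phase1_exit ::
  "('a::real_inner \<Rightarrow> real) \<Rightarrow> real \<Rightarrow> nat \<Rightarrow> (nat \<Rightarrow> 'a) \<Rightarrow> nat \<Rightarrow> bool" where
  "phase1_exit f \<epsilon>G K0 x K \<longleftrightarrow>
     \<not> phase1_guard f \<epsilon>G K0 x K \<and> (\<forall>k<K. phase1_guard f \<epsilon>G K0 x k)"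

text \<open>The sequence \<open>x\<close> is generated from the starting point \<open>x 0\<close>. Termination of the first phase is
  not presupposed: without an exit index, every step is a gradient step.\<close>

definition GRNM ::
  "nat \<Rightarrow> (nat \<Rightarrow> real^'p^'p) \<Rightarrow> (nat \<Rightarrow> real) \<Rightarrow> real \<Rightarrow> real \<Rightarrow> nat \<Rightarrow> real \<Rightarrow> real \<Rightarrow> real \<Rightarrow> real \<Rightarrow> real
    \<Rightarrow> (nat \<Rightarrow> real^'p) \<Rightarrow> bool" where
  "GRNM n A b \<epsilon>G \<beta> K0 \<mu>1 \<mu>2 \<alpha>1 \<alpha>2 \<delta> x \<longleftrightarrow>
     (let f = objective n A b in
       (\<forall>k. (\<forall>j\<le>k. phase1_guard f \<epsilon>G K0 x j) \<longrightarrow> x (Suc k) = phase1_step f \<mu>1 \<alpha>1 (x k)) \<and>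
       (\<forall>K. phase1_exit f \<epsilon>G K0 x K \<longrightarrow>
          (\<forall>k\<ge>K. x (Suc k) = phase2_step n A b \<beta> \<delta> \<mu>2 \<alpha>2 (x k))))"

definition accumulation_point :: "(nat \<Rightarrow> 'a::topological_space) \<Rightarrow> 'a \<Rightarrow> bool" where
  "accumulation_point x l \<longleftrightarrow> (\<exists>r::nat \<Rightarrow> nat. strict_mono r \<and> (x \<circ> r) \<longlonglongrightarrow> l)"

definition converges_with_rate :: "(nat \<Rightarrow> 'a::real_normed_vector) \<Rightarrow> 'a \<Rightarrow> real \<Rightarrow> bool" where
  "converges_with_rate x l q \<longleftrightarrow>
     x \<longlonglongrightarrow> l \<and> (\<exists>c. \<forall>\<^sub>F k in sequentially. norm (x (Suc k) - l) \<le> c * norm (x k - l) powr q)"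

lemma grad_eqI:
  assumes "GDERIV f x :> D"
  shows "grad f x = D"
  unfolding grad_def
proof (rule the_equality)
  fix D' assume "GDERIV f x :> D'"
  with assms have "(\<lambda>h. h \<bullet> D') = (\<lambda>h. h \<bullet> D)"
    unfolding gderiv_def by (rule has_derivative_unique[rotated])
  then show "D' = D"
    using vector_eq_ldot[of D' D] by (simp add: fun_eq_iff)
qed (fact assms)

lemma GDERIV_objective:
  assumes "\<And>i. i \<in> {1..n} \<Longrightarrow> transpose (A i) = A i"
  shows "GDERIV (objective n A b) x :> (1 / real n) *\<^sub>R (\<Sum>i=1..n. residual A b i x *\<^sub>R (A i *v x))"
proof -
  have res: "(residual A b i has_derivative (\<lambda>h. 2 * (h \<bullet> (A i *v x)))) (at x)"
    if "i \<in> {1..n}" for i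
  proof -
    have sym: "x \<bullet> (A i *v h) = h \<bullet> (A i *v x)" for h
      by (metis assms[OF that] dot_lmul_matrix inner_commute transpose_matrix_vector)
    have "((\<lambda>x. x \<bullet> (A i *v x) - b i) has_derivative
        (\<lambda>h. (x \<bullet> (A i *v h) + h \<bullet> (A i *v x)) - 0)) (at x)"
      by (intro has_derivative_diff has_derivative_inner has_derivative_ident has_derivative_const
            bounded_linear_imp_has_derivative matrix_vector_mul_bounded_linear)
    then show ?thesis
      by (simp add: residual_def[abs_def] sym)
  qed
  have sq: "((\<lambda>y. (residual A b i y)\<^sup>2) has_derivative
      (\<lambda>h. 2 * (2 * (h \<bullet> (A i *v x))) * residual A b i x)) (at x)" if "i \<in> {1..n}" for i
    using has_derivative_power[OF res[OF that], of 2] by (simp add: mult_ac)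
  have "(objective n A b has_derivative
      (\<lambda>h. 1 / (4 * real n) * (\<Sum>i=1..n. 2 * (2 * (h \<bullet> (A i *v x))) * residual A b i x))) (at x)"
    unfolding objective_def[abs_def] by (intro has_derivative_mult_right has_derivative_sum sq)
  then show ?thesis
    unfolding gderiv_def
    by (rule has_derivative_eq_rhs)
      (auto simp: inner_sum_right sum_distrib_left fun_eq_iff intro!: sum.cong)
qed

lemmas grad_objective = grad_eqI[OF GDERIV_objective]

end

theory Submission
  imports Defs
begin

text \<open>Write \<open>B x\<close> for the matrix \<open>1/n \<Sum> \<phi>\<^sub>i(x) A\<^sub>i\<close>. The gradient is \<open>g x = B x x\<close> and the Hessian is
  \<open>B x + H x\<close>, and since all the functions are polynomials in \<open>x\<close>, both admit exact finite
  expansions. All error terms are means of products of two bilinear forms \<open>\<langle>u, A\<^sub>i v\<rangle>\<close>, so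
  Cauchy-Schwarz and the upper bound \<open>\<eta>\<close> control every one of them (\<open>mean_form_bound\<close>), while the
  lower bound gives \<open>H x \<ge> 2 lam \<parallel>x\<parallel>\<^sup>2\<close>.

  \<^emph>\<open>The accumulation point \<open>y\<close> is stationary.\<close> In both phases the direction is a descent direction, so the
  objective never increases along the iterates. If \<open>g y\<close> were nonzero, then near \<open>y\<close>
  directions would be bounded and slopes bounded away from zero, so that any step starting near \<open>y\<close>
  would lower the objective by a fixed amount (\<open>decrease_near_nonstationary\<close>); this would happen
  infinitely often, although the objective is nonnegative. In particular the gradient is eventually small
  along a subsequence, which ends the first phase.

  \<^emph>\<open>The unit step is accepted near \<open>y\<close>.\<close> With \<open>d\<close> the Newton direction, the Armijo inequality for step
  size one is implied, up to terms of order \<open>o(\<parallel>d\<parallel>\<^sup>2)\<close>, by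
  \<open>\<langle>d, B y d\<rangle>/2 \<le> (1/2 - \<mu>) \<langle>d, H x d\<rangle>\<close>. This follows strictly from \<open>\<parallel>B y\<parallel> < 2 (1 - 2\<mu>) lam \<parallel>y\<parallel>\<^sup>2\<close>, and
  \<open>2 - 8/(5 - 4\<mu>\<^sup>2) < 2 (1 - 2\<mu>)\<close> for \<open>0 < \<mu> < 1/2\<close> (\<open>unit_step_accepted\<close>, \<open>residual_threshold_bounds\<close>).

  \<^emph>\<open>A unit step contracts.\<close> With \<open>e = x - y\<close> and the damping \<open>\<rho> = \<beta> \<parallel>g x\<parallel>\<^sup>\<delta>\<close>, the Newton equation and
  the expansion of \<open>g\<close> around \<open>y\<close> combine to the identity
  \<open>(H x + \<rho>) (x + d - y) = \<rho> e - B y e + 1/n \<Sum> \<langle>e, A\<^sub>i e\<rangle> A\<^sub>i x\<close>. Here \<open>\<rho> = O(\<parallel>e\<parallel>\<^sup>\<delta>)\<close>, so the three terms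
  give the contributions of order \<open>1 + \<delta>\<close>, \<open>1\<close> and \<open>2\<close>. The linear coefficient is about
  \<open>\<parallel>B y\<parallel> / (2 lam \<parallel>y\<parallel>\<^sup>2) < 1/5\<close>, which leaves room for the value \<open>1/4\<close> (\<open>newton_local_error\<close>), and it
  vanishes when all residuals vanish at \<open>y\<close>.

  \<^emph>\<open>Capture.\<close> Thus in a small ball around \<open>y\<close> every Newton step at least halves the distance to \<open>y\<close>. The iterates
  enter that ball because \<open>y\<close> is an accumulation point, and they never leave it again
  (\<open>contraction_capture\<close>), so the local estimates hold for all large \<open>k\<close>.\<close>

section \<open>Matrices and the spectral norm\<close>

lemma norm_le_from_inner:
  fixes v :: "'a::real_inner"
  assumes "v \<bullet> v \<le> c * norm v" and "0 \<le> c"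
  shows "norm v \<le> c"
  using assms
  by (cases "v = 0") (auto simp: dot_square_norm power2_eq_square)

lemma norm_mult_le_spectral_norm: "norm (M *v v) \<le> spectral_norm M * norm v"
  unfolding spectral_norm_def by (intro onorm matrix_vector_mul_bounded_linear)

lemma inner_mult_le_spectral_norm: "\<bar>u \<bullet> (M *v v)\<bar> \<le> spectral_norm M * norm u * norm v"
proof -
  have "\<bar>u \<bullet> (M *v v)\<bar> \<le> norm u * norm (M *v v)"
    by (rule Cauchy_Schwarz_ineq2)
  also have "\<dots> \<le> norm u * (spectral_norm M * norm v)"
    by (intro mult_left_mono norm_mult_le_spectral_norm) simp
  finally show ?thesis by (simp add: mult_ac)
qed

lemma spectral_norm_nonneg: "0 \<le> spectral_norm M"
  unfolding spectral_norm_def by (intro onorm_pos_le matrix_vector_mul_bounded_linear)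

lemma mat_vector_mult: "mat c *v v = c *\<^sub>R (v::real^'p)"
proof -
  have "mat c = c *\<^sub>R (mat 1 :: real^'p^'p)"
    by (simp add: mat_def vec_eq_iff)
  then show ?thesis
    by (simp flip: scaleR_matrix_vector_assoc)
qed

lemma sum_matrix_vector_mult:
  fixes M :: "'i \<Rightarrow> real^'p^'q"
  shows "(\<Sum>i\<in>I. M i) *v v = (\<Sum>i\<in>I. M i *v v)"
  by (induction I rule: infinite_finite_induct) (simp_all add: matrix_vector_mult_add_rdistrib)

lemma outer_vector_mult: "outer x y *v v = (y \<bullet> v) *\<^sub>R x"
  by (simp add: outer_def matrix_vector_mult_def vec_eq_iff inner_vec_def sum_distrib_left mult_ac)

lemma matrix_inv_mult_vector:
  fixes M :: "real^'p^'p"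
  assumes pos: "\<And>v. v \<noteq> 0 \<Longrightarrow> 0 < v \<bullet> (M *v v)"
  shows "M *v (matrix_inv M *v w) = w"
proof -
  have "inj ((*v) M)"
  proof (rule injI)
    fix u v assume "M *v u = M *v v"
    then have "(u - v) \<bullet> (M *v (u - v)) = 0"
      by (simp add: matrix_vector_mult_diff_distrib)
    with pos[of "u - v"] show "u = v" by fastforce
  qed
  then have "invertible M"
    by (simp add: invertible_left_inverse matrix_left_invertible_injective)
  then have "M ** matrix_inv M = mat 1"
    unfolding invertible_def matrix_inv_def by (metis (mono_tags, lifting) someI_ex)
  then show ?thesis
    by (simp add: matrix_vector_mul_assoc)
qed

section \<open>Exact expansions of the objective and its gradient\<close>

locale quadratic_measurements =
  fixes n :: nat and A :: "nat \<Rightarrow> real^'p^'p" and b :: "nat \<Rightarrow> real" and lam \<eta> :: real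
  assumes sym: "\<And>i. i \<in> {1..n} \<Longrightarrow> transpose (A i) = A i"
    and lam_pos: "lam > 0" and eta_pos: "\<eta> > 0"
    and lower: "\<And>u v. lam * (norm u)\<^sup>2 * (norm v)\<^sup>2 \<le> 1 / real n * (\<Sum>i=1..n. (u \<bullet> (A i *v v))\<^sup>2)"
    and upper: "\<And>u v. 1 / real n * (\<Sum>i=1..n. (u \<bullet> (A i *v v))\<^sup>2) \<le> \<eta> * (norm u)\<^sup>2 * (norm v)\<^sup>2"
begin

abbreviation f :: "real^'p \<Rightarrow> real" where "f \<equiv> objective n A b"
abbreviation g :: "real^'p \<Rightarrow> real^'p" where "g \<equiv> grad f"
abbreviation H :: "real^'p \<Rightarrow> real^'p^'p" where "H \<equiv> gn_matrix n A"
abbreviation B :: "real^'p \<Rightarrow> real^'p^'p" where "B \<equiv> residual_matrix n A b"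
abbreviation \<phi> :: "nat \<Rightarrow> real^'p \<Rightarrow> real" where "\<phi> \<equiv> residual A b"

definition mean :: "(nat \<Rightarrow> real) \<Rightarrow> real" where "mean p = 1 / real n * (\<Sum>i=1..n. p i)"

lemma form_sym: "i \<in> {1..n} \<Longrightarrow> u \<bullet> (A i *v v) = v \<bullet> (A i *v u)"
  by (metis sym dot_lmul_matrix inner_commute transpose_matrix_vector)

lemma inner_H: "u \<bullet> (H x *v v) = 2 * mean (\<lambda>i. (u \<bullet> (A i *v x)) * (v \<bullet> (A i *v x)))"
proof -
  have "(A i ** outer x x ** A i) *v v = (v \<bullet> (A i *v x)) *\<^sub>R (A i *v x)" if "i \<in> {1..n}" for i
    using form_sym[OF that, of x v]
    by (simp flip: matrix_vector_mul_assoc add: outer_vector_mult matrix_vector_mult_scaleR)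
  then have "u \<bullet> (H x *v v) = u \<bullet> ((2 / real n) *\<^sub>R (\<Sum>i=1..n. (v \<bullet> (A i *v x)) *\<^sub>R (A i *v x)))"
    unfolding gn_matrix_def
    by (simp flip: scaleR_matrix_vector_assoc add: sum_matrix_vector_mult)
  then show ?thesis
    by (simp add: mean_def inner_sum_right mult_ac)
qed

lemma inner_B: "u \<bullet> (B x *v v) = mean (\<lambda>i. \<phi> i x * (u \<bullet> (A i *v v)))"
  unfolding residual_matrix_def mean_def
  by (simp flip: scaleR_matrix_vector_assoc add: sum_matrix_vector_mult inner_sum_right)

lemma g_eq: "g x = B x *v x"
proof -
  have "g x = (1 / real n) *\<^sub>R (\<Sum>i=1..n. \<phi> i x *\<^sub>R (A i *v x))"
    by (rule grad_objective) (rule sym)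
  then show ?thesis
    unfolding residual_matrix_def
    by (simp only: scaleR_matrix_vector_assoc[symmetric] sum_matrix_vector_mult)
qed

lemma inner_g: "u \<bullet> g x = mean (\<lambda>i. \<phi> i x * (u \<bullet> (A i *v x)))"
  unfolding g_eq by (rule inner_B)

lemma mean_cong: "(\<And>i. i \<in> {1..n} \<Longrightarrow> p i = q i) \<Longrightarrow> mean p = mean q"
  by (simp add: mean_def)

lemma mean_nonneg: "(\<And>i. i \<in> {1..n} \<Longrightarrow> 0 \<le> p i) \<Longrightarrow> 0 \<le> mean p"
  unfolding mean_def by (intro mult_nonneg_nonneg sum_nonneg) auto

lemma mean_mono: "(\<And>i. i \<in> {1..n} \<Longrightarrow> p i \<le> q i) \<Longrightarrow> mean p \<le> mean q"
  unfolding mean_def by (intro mult_left_mono sum_mono) auto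

lemma mean_add: "mean (\<lambda>i. p i + q i) = mean p + mean q"
  by (simp only: mean_def sum.distrib distrib_left)

lemma mean_diff: "mean (\<lambda>i. p i - q i) = mean p - mean q"
  by (simp only: mean_def sum_subtractf right_diff_distrib)

lemma mean_mult: "mean (\<lambda>i. c * p i) = c * mean p"
  by (simp add: mean_def sum_distrib_left)

lemmas mean_form_lower = lower[folded mean_def]
lemmas mean_form_upper = upper[folded mean_def]

text \<open>Cauchy-Schwarz over the index \<open>i\<close> reduces the mixed mean to two means of squares, each bounded by
  the hypothesis with \<open>\<eta>\<close>. Every remainder term below is an instance.\<close>

lemma mean_form_bound:
  "\<bar>mean (\<lambda>i. (u \<bullet> (A i *v v)) * (w \<bullet> (A i *v z)))\<bar> \<le> \<eta> * norm u * norm v * norm w * norm z"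
proof -
  let ?p = "\<lambda>i. u \<bullet> (A i *v v)" and ?q = "\<lambda>i. w \<bullet> (A i *v z)"
  have "(mean (\<lambda>i. ?p i * ?q i))\<^sup>2 = (1 / real n)\<^sup>2 * (\<Sum>i=1..n. ?p i * ?q i)\<^sup>2"
    unfolding mean_def by (rule power_mult_distrib)
  also have "\<dots> \<le> (1 / real n)\<^sup>2 * ((\<Sum>i=1..n. (?p i)\<^sup>2) * (\<Sum>i=1..n. (?q i)\<^sup>2))"
    by (intro mult_left_mono Cauchy_Schwarz_ineq_sum) simp
  also have "\<dots> = mean (\<lambda>i. (?p i)\<^sup>2) * mean (\<lambda>i. (?q i)\<^sup>2)"
    by (simp add: mean_def power2_eq_square)
  also have "\<dots> \<le> (\<eta> * (norm u)\<^sup>2 * (norm v)\<^sup>2) * (\<eta> * (norm w)\<^sup>2 * (norm z)\<^sup>2)"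
    using eta_pos by (intro mult_mono[OF mean_form_upper mean_form_upper] mean_nonneg) auto
  also have "\<dots> = (\<eta> * norm u * norm v * norm w * norm z)\<^sup>2"
    by (simp add: power2_eq_square mult_ac)
  finally have "\<bar>mean (\<lambda>i. ?p i * ?q i)\<bar> \<le> \<bar>\<eta> * norm u * norm v * norm w * norm z\<bar>"
    by (simp only: abs_le_square_iff)
  then show ?thesis using eta_pos by (simp add: abs_mult)
qed

text \<open>Since \<open>\<langle>v, H x v\<rangle>\<close> is twice the mean of \<open>\<langle>v, A\<^sub>i x\<rangle>\<^sup>2\<close>, the Gauss-Newton matrix inherits both
  bounds of the hypothesis, with \<open>\<parallel>x\<parallel>\<^sup>2\<close> as a factor. This is why the accumulation point has to be nonzero.\<close>

lemma H_lower: "2 * lam * (norm x)\<^sup>2 * (norm v)\<^sup>2 \<le> v \<bullet> (H x *v v)"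
  using mean_form_lower[of v x] by (simp add: inner_H power2_eq_square mult_ac)

lemma H_upper: "\<bar>u \<bullet> (H x *v v)\<bar> \<le> 2 * \<eta> * (norm x)\<^sup>2 * norm u * norm v"
  using mean_form_bound[of u x v x] by (simp add: inner_H power2_eq_square mult_ac abs_mult)

lemma residual_add:
  assumes "i \<in> {1..n}"
  shows "\<phi> i (x + d) = \<phi> i x + 2 * (d \<bullet> (A i *v x)) + d \<bullet> (A i *v d)"
  using form_sym[OF assms, of x d]
  by (simp add: residual_def matrix_vector_right_distrib inner_add_left inner_add_right)

lemma objective_mean: "f x = mean (\<lambda>i. (\<phi> i x)\<^sup>2) / 4"
  by (simp add: objective_def mean_def)

lemma objective_nonneg: "0 \<le> f x"
  unfolding objective_def by (intro mult_nonneg_nonneg sum_nonneg) auto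

text \<open>The Taylor expansion of the quartic objective, obtained by squaring
  \<open>\<phi>\<^sub>i (x + d) = \<phi>\<^sub>i x + 2 \<langle>d, A\<^sub>i x\<rangle> + \<langle>d, A\<^sub>i d\<rangle>\<close>.\<close>

lemma objective_expand:
  "f (x + d) = f x + d \<bullet> g x + (d \<bullet> (H x *v d)) / 2 + (d \<bullet> (B x *v d)) / 2
     + mean (\<lambda>i. (d \<bullet> (A i *v x)) * (d \<bullet> (A i *v d))) + mean (\<lambda>i. (d \<bullet> (A i *v d))\<^sup>2) / 4"
proof -
  let ?a = "\<lambda>i. \<phi> i x" and ?p = "\<lambda>i. d \<bullet> (A i *v x)" and ?q = "\<lambda>i. d \<bullet> (A i *v d)"
  have "(\<phi> i (x + d))\<^sup>2 = (?a i)\<^sup>2 + 4 * (?a i * ?p i) + 4 * (?p i * ?p i) + 2 * (?a i * ?q i)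
      + 4 * (?p i * ?q i) + (?q i)\<^sup>2" if "i \<in> {1..n}" for i
    unfolding residual_add[OF that] by (simp add: power2_eq_square algebra_simps)
  then have "mean (\<lambda>i. (\<phi> i (x + d))\<^sup>2) = mean (\<lambda>i. (?a i)\<^sup>2 + 4 * (?a i * ?p i) + 4 * (?p i * ?p i)
      + 2 * (?a i * ?q i) + 4 * (?p i * ?q i) + (?q i)\<^sup>2)"
    by (rule mean_cong)
  then show ?thesis
    unfolding mean_add mean_mult objective_mean inner_g inner_H inner_B by linarith
qed

text \<open>The residual at \<open>y\<close> is expanded around \<open>x\<close>, so that the linear term carries \<open>H x\<close>, the undamped matrix
  of the Newton system at \<open>x\<close>, and cancels against it in \<open>newton_error\<close>. The stationarity of \<open>y\<close> turns
  \<open>B y x\<close> into \<open>B y (x - y)\<close>.\<close>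

lemma inner_g_expand:
  assumes "g y = 0"
  shows "w \<bullet> g x = w \<bullet> (B y *v (x - y)) + w \<bullet> (H x *v (x - y))
    - mean (\<lambda>i. ((x - y) \<bullet> (A i *v (x - y))) * (w \<bullet> (A i *v x)))"
proof -
  define e where "e = x - y"
  have phi: "\<phi> i x = \<phi> i y + 2 * (e \<bullet> (A i *v x)) - e \<bullet> (A i *v e)" if "i \<in> {1..n}" for i
  proof -
    have "y = x + - e" by (simp add: e_def)
    then show ?thesis
      using residual_add[OF that, of x "- e"]
      by (simp add: linear_neg[OF matrix_vector_mul_linear])
  qed
  have "w \<bullet> g x = mean (\<lambda>i. \<phi> i y * (w \<bullet> (A i *v x))
      + 2 * ((w \<bullet> (A i *v x)) * (e \<bullet> (A i *v x))) - (e \<bullet> (A i *v e)) * (w \<bullet> (A i *v x)))"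
    unfolding inner_g by (rule mean_cong) (simp add: phi algebra_simps)
  also have "\<dots> = w \<bullet> (B y *v x) + w \<bullet> (H x *v e)
      - mean (\<lambda>i. (e \<bullet> (A i *v e)) * (w \<bullet> (A i *v x)))"
    by (simp only: mean_diff mean_add mean_mult inner_B inner_H)
  also have "w \<bullet> (B y *v x) = w \<bullet> (B y *v e)"
    using assms unfolding g_eq e_def by (simp add: matrix_vector_mult_diff_distrib)
  finally show ?thesis unfolding e_def .
qed

lemma g_bound:
  assumes "g y = 0"
  shows "norm (g x) \<le> (2 * \<eta> * (norm x)\<^sup>2 + spectral_norm (B y) + \<eta> * norm x * norm (x - y)) * norm (x - y)"
proof (rule norm_le_from_inner)
  define w e where "w = g x" and "e = x - y"
  have "w \<bullet> w = w \<bullet> (B y *v e) + w \<bullet> (H x *v e) - mean (\<lambda>i. (e \<bullet> (A i *v e)) * (w \<bullet> (A i *v x)))"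
    using inner_g_expand[OF assms, of w x] unfolding w_def e_def .
  also have "\<dots> \<le> spectral_norm (B y) * norm w * norm e + 2 * \<eta> * (norm x)\<^sup>2 * norm w * norm e
      + \<eta> * norm e * norm e * norm w * norm x"
    using inner_mult_le_spectral_norm[of w "B y" e] H_upper[of w x e] mean_form_bound[of e e w x]
    by linarith
  finally show "g x \<bullet> g x
      \<le> (2 * \<eta> * (norm x)\<^sup>2 + spectral_norm (B y) + \<eta> * norm x * norm (x - y)) * norm (x - y) * norm (g x)"
    unfolding w_def[symmetric] e_def[symmetric] by (simp add: algebra_simps)
next
  show "0 \<le> (2 * \<eta> * (norm x)\<^sup>2 + spectral_norm (B y) + \<eta> * norm x * norm (x - y)) * norm (x - y)"
    using eta_pos spectral_norm_nonneg[of "B y"]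
    by (intro mult_nonneg_nonneg add_nonneg_nonneg) auto
qed

lemma continuous_g: "isCont g y"
proof -
  have "isCont (\<lambda>x. A i *v x) y" for i
    by (intro linear_continuous_at matrix_vector_mul_bounded_linear)
  then have "isCont (\<lambda>x. (1 / real n) *\<^sub>R (\<Sum>i=1..n. (x \<bullet> (A i *v x) - b i) *\<^sub>R (A i *v x))) y"
    by (intro continuous_scaleR continuous_sum continuous_diff continuous_inner continuous_const
        continuous_ident)
  moreover have "g = (\<lambda>x. (1 / real n) *\<^sub>R (\<Sum>i=1..n. (x \<bullet> (A i *v x) - b i) *\<^sub>R (A i *v x)))"
    by (rule ext, subst grad_objective[OF sym]) (simp_all add: residual_def)
  ultimately show ?thesis by simp
qed

lemma continuous_objective: "isCont f y"
  using GDERIV_objective[of n A b y] sym unfolding gderiv_def by (blast intro: has_derivative_continuous)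

lemma damped_newton_system:
  assumes "x \<noteq> 0" and "0 \<le> \<rho>"
  shows "(H x + mat \<rho>) *v (matrix_inv (H x + mat \<rho>) *v w) = w"
proof (rule matrix_inv_mult_vector)
  fix v :: "real^'p" assume "v \<noteq> 0"
  have "0 < 2 * lam * (norm x)\<^sup>2 * (norm v)\<^sup>2"
    using \<open>v \<noteq> 0\<close> \<open>x \<noteq> 0\<close> lam_pos by simp
  also have "\<dots> \<le> v \<bullet> (H x *v v)" by (rule H_lower)
  also have "\<dots> \<le> v \<bullet> ((H x + mat \<rho>) *v v)"
    using \<open>0 \<le> \<rho>\<close> by (simp add: matrix_vector_mult_add_rdistrib mat_vector_mult inner_add_right)
  finally show "0 < v \<bullet> ((H x + mat \<rho>) *v v)" .
qed

end
section \<open>Backtracking line search\<close>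

text \<open>A step \<open>t\<close> with \<open>t Q \<le> (1 - \<mu>) (- m)\<close> satisfies the Armijo inequality, because the quadratic
  term then uses up only the share \<open>1 - \<mu>\<close> of the predicted decrease. Hence backtracking stops, and the last
  rejected step, which is \<open>\<tau> / \<alpha>\<close> when there is one, violates that condition; this is the lower bound on \<open>\<tau>\<close>.\<close>

lemma armijo_step_spec:
  fixes F :: "'a::real_vector \<Rightarrow> real"
  assumes quad: "\<And>t. 0 < t \<Longrightarrow> t \<le> 1 \<Longrightarrow> F (x + t *\<^sub>R d) \<le> F x + t * m + t\<^sup>2 * Q"
    and m: "m < 0" and Q: "0 \<le> Q" and \<mu>: "\<mu> \<in> {0<..<1}" and \<alpha>: "\<alpha> \<in> {0<..<1}"
  defines "\<tau> \<equiv> armijo_step F \<mu> \<alpha> x d m"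
  shows "F (x + \<tau> *\<^sub>R d) \<le> F x + \<mu> * \<tau> * m"
    and "0 < \<tau>"
    and "\<tau> = 1 \<or> \<alpha> * (1 - \<mu>) * (- m) \<le> \<tau> * Q"
proof -
  define P where "P j \<longleftrightarrow> F (x + \<alpha> ^ j *\<^sub>R d) \<le> F x + \<mu> * \<alpha> ^ j * m" for j
  define J where "J = (LEAST j. P j)"
  have \<tau>: "\<tau> = \<alpha> ^ J"
    by (simp add: \<tau>_def armijo_step_def J_def P_def)
  have accept: "P j" if "\<alpha> ^ j * Q \<le> (1 - \<mu>) * (- m)" for j
  proof -
    let ?t = "\<alpha> ^ j"
    have t: "0 < ?t" "?t \<le> 1"
      using \<alpha> by (auto intro: power_le_one)
    have "?t * (?t * Q) \<le> ?t * ((1 - \<mu>) * (- m))"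
      using that t by (intro mult_left_mono) auto
    with quad[OF t] show ?thesis
      by (simp add: P_def power2_eq_square algebra_simps)
  qed
  have "0 < (1 - \<mu>) * (- m) / (Q + 1)"
    using m Q \<mu> by (intro divide_pos_pos mult_pos_pos) auto
  then obtain j where "\<alpha> ^ j < (1 - \<mu>) * (- m) / (Q + 1)"
    using \<alpha> by (metis greaterThanLessThan_iff real_arch_pow_inv)
  then have "\<alpha> ^ j * (Q + 1) < (1 - \<mu>) * (- m)"
    using Q by (subst (asm) pos_less_divide_eq) auto
  moreover have "0 < \<alpha> ^ j" using \<alpha> by simp
  ultimately have "\<alpha> ^ j * Q \<le> (1 - \<mu>) * (- m)"
    unfolding distrib_left by linarith
  then have "P J"
    unfolding J_def by (rule LeastI[OF accept])
  then show "F (x + \<tau> *\<^sub>R d) \<le> F x + \<mu> * \<tau> * m"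
    by (simp add: P_def \<tau>)
  show "0 < \<tau>" using \<alpha> by (simp add: \<tau>)
  show "\<tau> = 1 \<or> \<alpha> * (1 - \<mu>) * (- m) \<le> \<tau> * Q"
  proof (cases J)
    case 0
    then show ?thesis by (simp add: \<tau>)
  next
    case (Suc i)
    then have "\<not> P i"
      unfolding J_def using not_less_Least[of i P] by simp
    then have "(1 - \<mu>) * (- m) \<le> \<alpha> ^ i * Q"
      using accept[of i] by linarith
    then have "\<alpha> * ((1 - \<mu>) * (- m)) \<le> \<alpha> * (\<alpha> ^ i * Q)"
      using \<alpha> by (intro mult_left_mono) auto
    then show ?thesis by (simp add: \<tau> Suc mult_ac)
  qed
qed

lemma armijo_step_decrease:
  fixes F :: "'a::real_vector \<Rightarrow> real"
  assumes quad: "\<And>t. 0 < t \<Longrightarrow> t \<le> 1 \<Longrightarrow> F (x + t *\<^sub>R d) \<le> F x + t * m + t\<^sup>2 * Q"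
    and s: "0 < s" "m \<le> - s" and Q: "0 < Q" and \<mu>: "\<mu> \<in> {0<..<1}" and \<alpha>: "\<alpha> \<in> {0<..<1}"
  shows "F (x + armijo_step F \<mu> \<alpha> x d m *\<^sub>R d)
    \<le> F x - \<mu> * s * min 1 (\<alpha> * (1 - \<mu>) * s / Q)"
proof -
  define \<tau> where "\<tau> = armijo_step F \<mu> \<alpha> x d m"
  have m: "m < 0" using s by simp
  note spec = armijo_step_spec[OF quad m less_imp_le[OF Q] \<mu> \<alpha>, folded \<tau>_def, simplified]
  have "min 1 (\<alpha> * (1 - \<mu>) * s / Q) \<le> \<tau>"
  proof (cases "\<tau> = 1")
    case False
    have "\<alpha> * (1 - \<mu>) * s \<le> \<alpha> * (1 - \<mu>) * (- m)"
      using s \<mu> \<alpha> by (intro mult_left_mono) auto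
    also have "\<dots> \<le> \<tau> * Q" using spec(3) False by auto
    finally show ?thesis using Q by (simp add: pos_divide_le_eq min.coboundedI2)
  qed simp
  then have "s * min 1 (\<alpha> * (1 - \<mu>) * s / Q) \<le> (- m) * \<tau>"
    using s \<alpha> \<mu> Q by (intro mult_mono) auto
  then have "\<mu> * (s * min 1 (\<alpha> * (1 - \<mu>) * s / Q)) \<le> \<mu> * ((- m) * \<tau>)"
    using \<mu> by (intro mult_left_mono) auto
  with spec(1) show ?thesis
    unfolding \<tau>_def[symmetric] by (simp add: algebra_simps)
qed

lemma armijo_step_unit:
  assumes "F (x + d) \<le> F x + \<mu> * m"
  shows "armijo_step F \<mu> \<alpha> x d m = 1"
proof -
  have "(LEAST j::nat. F (x + \<alpha> ^ j *\<^sub>R d) \<le> F x + \<mu> * \<alpha> ^ j * m) = 0"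
    using assms by (intro Least_eq_0) simp
  then show ?thesis by (simp add: armijo_step_def)
qed

context quadratic_measurements
begin

lemma objective_line_bound:
  assumes "0 \<le> t" and "t \<le> 1"
  shows "f (x + t *\<^sub>R d) \<le> f x + t * (g x \<bullet> d)
    + t\<^sup>2 * (f x + \<eta> * (norm x)\<^sup>2 * (norm d)\<^sup>2 + \<eta> * norm x * norm d ^ 3 + \<eta> * norm d ^ 4)"
proof -
  let ?p = "\<lambda>i. d \<bullet> (A i *v x)" and ?q = "\<lambda>i. d \<bullet> (A i *v d)"
  have q2: "mean (\<lambda>i. (?q i)\<^sup>2) \<le> \<eta> * norm d ^ 4"
    using mean_form_upper[of d d] by (simp add: power2_eq_square power4_eq_xxxx mult_ac)
  have pq: "\<bar>mean (\<lambda>i. ?p i * ?q i)\<bar> \<le> \<eta> * norm x * norm d ^ 3"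
    using mean_form_bound[of d x d d] by (simp add: power3_eq_cube mult_ac)
  have h: "d \<bullet> (H x *v d) \<le> 2 * \<eta> * (norm x)\<^sup>2 * (norm d)\<^sup>2"
    using H_upper[of d x d] by (simp add: power2_eq_square mult_ac)
  \<comment> \<open>Splitting \<open>\<phi>\<^sub>i \<langle>d, A\<^sub>i d\<rangle>\<close> by \<open>2ab \<le> a\<^sup>2 + b\<^sup>2\<close> bounds the residual term by the objective value, so no
    bound on the individual residuals is involved.\<close>
  have "d \<bullet> (B x *v d) \<le> mean (\<lambda>i. (1/2) * (\<phi> i x)\<^sup>2 + (1/2) * (?q i)\<^sup>2)"
    unfolding inner_B using sum_squares_bound[of "\<phi> _ x" "?q _"]
    by (intro mean_mono) (simp add: field_simps)
  also have "\<dots> = 2 * f x + mean (\<lambda>i. (?q i)\<^sup>2) / 2"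
    unfolding mean_add mean_mult objective_mean by simp
  finally have B: "(d \<bullet> (B x *v d)) / 2 \<le> f x + \<eta> * norm d ^ 4 / 4"
    using q2 by simp
  define r where "r = mean (\<lambda>i. ?p i * ?q i)"
  define z where "z = mean (\<lambda>i. (?q i)\<^sup>2)"
  have "f (x + t *\<^sub>R d) = f x + t * (g x \<bullet> d)
      + t\<^sup>2 * ((d \<bullet> (H x *v d)) / 2 + (d \<bullet> (B x *v d)) / 2 + t * r + t\<^sup>2 * z / 4)"
  proof -
    have "mean (\<lambda>i. ((t *\<^sub>R d) \<bullet> (A i *v x)) * ((t *\<^sub>R d) \<bullet> (A i *v (t *\<^sub>R d)))) = t ^ 3 * r"
      unfolding r_def mean_mult[symmetric]
      by (rule mean_cong) (simp add: matrix_vector_mult_scaleR power3_eq_cube)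
    moreover have "mean (\<lambda>i. ((t *\<^sub>R d) \<bullet> (A i *v (t *\<^sub>R d)))\<^sup>2) = t ^ 4 * z"
      unfolding z_def mean_mult[symmetric]
      by (rule mean_cong) (simp add: matrix_vector_mult_scaleR power4_eq_xxxx power2_eq_square)
    ultimately show ?thesis
      unfolding objective_expand[of x "t *\<^sub>R d"]
      by (simp add: matrix_vector_mult_scaleR power3_eq_cube power4_eq_xxxx power2_eq_square
          inner_commute[of "g x"] algebra_simps)
  qed
  moreover have "t * r \<le> \<eta> * norm x * norm d ^ 3"
  proof -
    have "t * r \<le> t * \<bar>r\<bar>" using assms by (intro mult_left_mono) auto
    also have "\<dots> \<le> \<bar>r\<bar>" using assms by (intro mult_left_le_one_le) auto
    finally show ?thesis using pq unfolding r_def by linarith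
  qed
  moreover have "t\<^sup>2 * z \<le> \<eta> * norm d ^ 4"
  proof -
    have "t\<^sup>2 * z \<le> z"
      using assms by (intro mult_left_le_one_le) (auto simp: z_def power_le_one intro: mean_nonneg)
    then show ?thesis using q2 unfolding z_def by linarith
  qed
  moreover have "0 \<le> \<eta> * norm d ^ 4" using eta_pos by simp
  ultimately show ?thesis
    using h B by (simp del: mult_le_cancel_left) (intro mult_left_mono, auto)
qed

text \<open>On bounded data the curvature constant of \<open>objective_line_bound\<close> is uniformly bounded, so a slope
  of at most \<open>- s\<close> buys a decrease that depends only on the bounds.\<close>

lemma armijo_uniform_decrease:
  assumes \<mu>: "\<mu> \<in> {0<..<1}" and \<alpha>: "\<alpha> \<in> {0<..<1}" and s: "0 < s"
    and "0 \<le> R" "0 \<le> D" "0 \<le> F"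
  obtains \<kappa> where "0 < \<kappa>"
    and "\<And>x d. \<lbrakk>norm x \<le> R; norm d \<le> D; f x \<le> F; g x \<bullet> d \<le> - s\<rbrakk> \<Longrightarrow>
      f (x + armijo_step f \<mu> \<alpha> x d (g x \<bullet> d) *\<^sub>R d) \<le> f x - \<kappa>"
proof -
  define Q where "Q = F + \<eta> * R\<^sup>2 * D\<^sup>2 + \<eta> * R * D ^ 3 + \<eta> * D ^ 4 + 1"
  have Q: "0 < Q"
    unfolding Q_def using assms eta_pos by (intro add_nonneg_pos add_nonneg_nonneg) auto
  have "f (x + armijo_step f \<mu> \<alpha> x d (g x \<bullet> d) *\<^sub>R d)
      \<le> f x - \<mu> * s * min 1 (\<alpha> * (1 - \<mu>) * s / Q)"
    if "norm x \<le> R" "norm d \<le> D" "f x \<le> F" "g x \<bullet> d \<le> - s" for x d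
  proof (rule armijo_step_decrease[OF _ s that(4) Q \<mu> \<alpha>])
    fix t :: real assume t: "0 < t" "t \<le> 1"
    have "f x + \<eta> * (norm x)\<^sup>2 * (norm d)\<^sup>2 + \<eta> * norm x * norm d ^ 3 + \<eta> * norm d ^ 4
        \<le> F + \<eta> * R\<^sup>2 * D\<^sup>2 + \<eta> * R * D ^ 3 + \<eta> * D ^ 4"
      using that eta_pos assms by (intro add_mono mult_mono power_mono) auto
    then have "t\<^sup>2 * (f x + \<eta> * (norm x)\<^sup>2 * (norm d)\<^sup>2 + \<eta> * norm x * norm d ^ 3 + \<eta> * norm d ^ 4)
        \<le> t\<^sup>2 * Q"
      unfolding Q_def by (intro mult_left_mono) auto
    with objective_line_bound[of t x d] t
    show "f (x + t *\<^sub>R d) \<le> f x + t * (g x \<bullet> d) + t\<^sup>2 * Q" by linarith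
  qed
  moreover have "0 < \<mu> * s * min 1 (\<alpha> * (1 - \<mu>) * s / Q)"
    using \<mu> \<alpha> s Q by auto
  ultimately show ?thesis using that by blast
qed

lemma phase1_step_eq:
  "phase1_step f \<mu> \<alpha> x = x + armijo_step f \<mu> \<alpha> x (- g x) (g x \<bullet> (- g x)) *\<^sub>R (- g x)"
  by (simp add: phase1_step_def Let_def power2_norm_eq_inner)

lemma phase2_step_eq:
  "phase2_step n A b \<beta> \<delta> \<mu> \<alpha> x = x + armijo_step f \<mu> \<alpha> x (newton_dir n A b \<beta> \<delta> x)
     (g x \<bullet> newton_dir n A b \<beta> \<delta> x) *\<^sub>R newton_dir n A b \<beta> \<delta> x"
  by (simp add: phase2_step_def Let_def)

lemma nonzero_if_grad_nonzero: "g x \<noteq> 0 \<Longrightarrow> x \<noteq> 0"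
  by (auto simp: g_eq)

end

section \<open>The regularized Newton direction\<close>

locale regularized_newton = quadratic_measurements n A b lam \<eta>
  for n :: nat and A :: "nat \<Rightarrow> real^'p^'p" and b :: "nat \<Rightarrow> real" and lam \<eta> :: real +
  fixes \<beta> \<delta> :: real
  assumes \<beta>: "0 < \<beta>" and \<delta>: "\<delta> \<in> {0<..<1}"
begin

abbreviation \<rho> :: "real^'p \<Rightarrow> real" where "\<rho> x \<equiv> \<beta> * norm (g x) powr \<delta>"
abbreviation d :: "real^'p \<Rightarrow> real^'p" where "d \<equiv> newton_dir n A b \<beta> \<delta>"

lemma damping_nonneg: "0 \<le> \<rho> x"
  using \<beta> by simp

lemma newton_equation:
  assumes "x \<noteq> 0"
  shows "H x *v d x + \<rho> x *\<^sub>R d x = - g x"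
proof -
  have "(H x + mat (\<rho> x)) *v d x = - g x"
    unfolding newton_dir_def Let_def
    by (simp add: linear_neg[OF matrix_vector_mul_linear]
        damped_newton_system[OF assms damping_nonneg])
  then show ?thesis
    by (simp add: matrix_vector_mult_add_rdistrib mat_vector_mult)
qed

lemma newton_inner:
  assumes "x \<noteq> 0"
  shows "w \<bullet> g x = - (w \<bullet> (H x *v d x)) - \<rho> x * (w \<bullet> d x)"
proof -
  have "w \<bullet> (- g x) = w \<bullet> (H x *v d x + \<rho> x *\<^sub>R d x)"
    by (simp add: newton_equation[OF assms])
  then show ?thesis
    by (simp add: inner_add_right)
qed

lemma newton_slope:
  assumes "x \<noteq> 0"
  shows "g x \<bullet> d x \<le> - (2 * lam * (norm x)\<^sup>2 * (norm (d x))\<^sup>2)"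
proof -
  have "0 \<le> \<rho> x * (d x \<bullet> d x)"
    by (intro mult_nonneg_nonneg damping_nonneg) simp
  then show ?thesis
    using newton_inner[OF assms, of "d x"] H_lower[of x "d x"]
    by (simp add: inner_commute[of "g x"])
qed

lemma newton_dir_upper:
  assumes "x \<noteq> 0"
  shows "2 * lam * (norm x)\<^sup>2 * norm (d x) \<le> norm (g x)"
proof (cases "d x = 0")
  case False
  have "(2 * lam * (norm x)\<^sup>2 * norm (d x)) * norm (d x) \<le> - (g x \<bullet> d x)"
    using newton_slope[OF assms] by (simp add: power2_eq_square mult_ac)
  also have "\<dots> \<le> norm (g x) * norm (d x)"
    using Cauchy_Schwarz_ineq2[of "g x" "d x"] by linarith
  finally show ?thesis using False by simp
qed simp

text \<open>The Newton direction cannot be short where the gradient is not, since \<open>H x + \<rho> x\<close> is bounded.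
  Together with \<open>newton_slope\<close> this bounds the slope away from zero near a nonstationary point.\<close>

lemma newton_dir_lower:
  assumes "x \<noteq> 0"
  shows "norm (g x) \<le> (2 * \<eta> * (norm x)\<^sup>2 + \<rho> x) * norm (d x)"
proof (rule norm_le_from_inner)
  have "\<rho> x * (- (g x \<bullet> d x)) \<le> \<rho> x * (norm (g x) * norm (d x))"
    using Cauchy_Schwarz_ineq2[of "g x" "d x"] by (intro mult_left_mono damping_nonneg) linarith
  then show "g x \<bullet> g x \<le> (2 * \<eta> * (norm x)\<^sup>2 + \<rho> x) * norm (d x) * norm (g x)"
    using newton_inner[OF assms, of "g x"] H_upper[of "g x" x "d x"] 
    by (simp add: algebra_simps)
  show "0 \<le> (2 * \<eta> * (norm x)\<^sup>2 + \<rho> x) * norm (d x)"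
    using eta_pos by (intro mult_nonneg_nonneg add_nonneg_nonneg damping_nonneg) auto
qed

text \<open>With \<open>w = x + d x - y\<close> and \<open>e = x - y\<close>, adding \<open>(H x + \<rho> x) e\<close> to the Newton equation and expanding
  \<open>g x\<close> around \<open>y\<close> cancels \<open>H x e\<close>, which leaves
  \<open>(H x + \<rho> x) w = \<rho> x e - B y e + 1/n \<Sum> \<langle>e, A\<^sub>i e\<rangle> A\<^sub>i x\<close>. Testing this with \<open>w\<close> itself brings in the lower
  bound of \<open>H x\<close>, and one factor \<open>\<parallel>w\<parallel>\<close> is then cancelled.\<close>

lemma newton_error:
  assumes "x \<noteq> 0" and y: "g y = 0"
  shows "2 * lam * (norm x)\<^sup>2 * norm (x + d x - y)
    \<le> (\<rho> x + spectral_norm (B y)) * norm (x - y) + \<eta> * norm x * (norm (x - y))\<^sup>2"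
proof -
  define e w where "e = x - y" and "w = x + d x - y"
  have w: "w = e + d x" by (simp add: e_def w_def)
  have "w \<bullet> (H x *v w) + \<rho> x * (w \<bullet> w) = w \<bullet> (H x *v e) + \<rho> x * (w \<bullet> e) - w \<bullet> g x"
    unfolding newton_inner[OF \<open>x \<noteq> 0\<close>, of w]
    by (subst (2 4) w) (simp add: matrix_vector_right_distrib inner_add_right distrib_left)
  also have "\<dots> = \<rho> x * (w \<bullet> e) - w \<bullet> (B y *v e)
      + mean (\<lambda>i. (e \<bullet> (A i *v e)) * (w \<bullet> (A i *v x)))"
    using inner_g_expand[OF y, of w x] by (simp add: e_def)
  also have "\<dots> \<le> \<rho> x * (norm w * norm e) + spectral_norm (B y) * norm w * norm e
      + \<eta> * norm e * norm e * norm w * norm x"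
  proof -
    have "\<rho> x * (w \<bullet> e) \<le> \<rho> x * (norm w * norm e)"
      by (intro mult_left_mono damping_nonneg norm_cauchy_schwarz)
    then show ?thesis
      using inner_mult_le_spectral_norm[of w "B y" e] mean_form_bound[of e e w x] by linarith
  qed
  finally have "w \<bullet> (H x *v w) + \<rho> x * (w \<bullet> w)
      \<le> ((\<rho> x + spectral_norm (B y)) * norm e + \<eta> * norm x * (norm e)\<^sup>2) * norm w"
    by (simp add: algebra_simps power2_eq_square)
  moreover have "0 \<le> \<rho> x * (w \<bullet> w)"
    by (intro mult_nonneg_nonneg damping_nonneg) simp
  ultimately have le: "(2 * lam * (norm x)\<^sup>2 * norm w) * norm w
      \<le> ((\<rho> x + spectral_norm (B y)) * norm e + \<eta> * norm x * (norm e)\<^sup>2) * norm w"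
    using H_lower[of x w] by (simp add: power2_eq_square mult_ac)
  show ?thesis
    unfolding e_def[symmetric] w_def[symmetric]
  proof (cases "w = 0")
    case True
    then show "2 * lam * (norm x)\<^sup>2 * norm w
        \<le> (\<rho> x + spectral_norm (B y)) * norm e + \<eta> * norm x * (norm e)\<^sup>2"
      using eta_pos damping_nonneg[of x] spectral_norm_nonneg[of "B y"] by simp
  next
    case False
    then show "2 * lam * (norm x)\<^sup>2 * norm w
        \<le> (\<rho> x + spectral_norm (B y)) * norm e + \<eta> * norm x * (norm e)\<^sup>2"
      using mult_right_le_imp_le[OF le] by simp
  qed
qed

end

section \<open>Sequences with an accumulation point\<close>

lemma accumulation_point_frequently:
  assumes "accumulation_point x y" and "eventually P (nhds y)"
  shows "\<exists>\<^sub>F k in sequentially. P (x k)"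
proof -
  from assms(1) obtain r where r: "strict_mono r" "(x \<circ> r) \<longlonglongrightarrow> y"
    unfolding accumulation_point_def by blast
  have ev: "\<forall>\<^sub>F k in sequentially. P (x (r k))"
    using r(2) assms(2) unfolding filterlim_iff by auto
  show ?thesis
    unfolding frequently_sequentially
  proof
    fix N
    from ev obtain M where "\<And>k. k \<ge> M \<Longrightarrow> P (x (r k))"
      unfolding eventually_sequentially by blast
    then have "P (x (r (max M N)))" by simp
    moreover have "N \<le> r (max M N)"
      using seq_suble[OF r(1), of "max M N"] by simp
    ultimately show "\<exists>k\<ge>N. P (x k)" by blast
  qed
qed

lemma no_frequent_decrease:
  fixes F :: "nat \<Rightarrow> real"
  assumes "decseq F" and "\<And>k. 0 \<le> F k" and "0 < \<kappa>"
  shows "\<not> (\<exists>\<^sub>F k in sequentially. F (Suc k) \<le> F k - \<kappa>)"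
proof -
  obtain L where L: "F \<longlonglongrightarrow> L"
    using decseq_convergent[OF assms(1), of 0] assms(2) by blast
  have "(\<lambda>k. F k - F (Suc k)) \<longlonglongrightarrow> L - L"
    by (intro tendsto_diff L LIMSEQ_Suc)
  then have "\<forall>\<^sub>F k in sequentially. F k - F (Suc k) < \<kappa>"
    using \<open>0 < \<kappa>\<close> by (intro order_tendstoD(2)) auto
  then show ?thesis
    unfolding not_frequently by (rule eventually_mono) simp
qed

text \<open>The accumulation point attracts the whole sequence: some iterate of index at least \<open>K\<close> lies in the ball, and
  halving the distance keeps all later iterates inside it.\<close>

lemma contraction_capture:
  fixes x :: "nat \<Rightarrow> 'a::real_normed_vector"
  assumes acc: "accumulation_point x y" and "0 < r"
    and contr: "\<And>k. k \<ge> K \<Longrightarrow> norm (x k - y) < r \<Longrightarrow> norm (x (Suc k) - y) \<le> norm (x k - y) / 2"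
  shows "x \<longlonglongrightarrow> y"
proof -
  have "\<forall>\<^sub>F z in nhds y. norm (z - y) < r"
    using \<open>0 < r\<close> by (auto simp: eventually_nhds_metric dist_norm)
  from accumulation_point_frequently[OF acc this]
  obtain k where k: "k \<ge> K" "norm (x k - y) < r"
    unfolding frequently_sequentially by blast
  have bound: "norm (x (j + k) - y) \<le> (1 / 2 :: real) ^ j * r \<and> norm (x (j + k) - y) < r" for j
  proof (induction j)
    case 0
    then show ?case using k by simp
  next
    case (Suc j)
    then have "norm (x (Suc (j + k)) - y) \<le> norm (x (j + k) - y) / 2"
      using k by (intro contr) auto
    moreover have "0 \<le> norm (x (j + k) - y)" by simp
    moreover have "norm (x (Suc j + k) - y) = norm (x (Suc (j + k)) - y)" by simp
    moreover have "(1 / 2) ^ Suc j * r = (1 / 2) ^ j * r / 2" by simp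
    ultimately show ?case using Suc.IH by linarith
  qed
  have "(\<lambda>j. (1 / 2 :: real) ^ j * r) \<longlonglongrightarrow> 0 * r"
    by (intro tendsto_mult LIMSEQ_power_zero tendsto_const) simp
  then have "(\<lambda>j. (1 / 2 :: real) ^ j * r) \<longlonglongrightarrow> 0"
    by simp
  then have "(\<lambda>j. x (j + k) - y) \<longlonglongrightarrow> 0"
    by (rule Lim_null_comparison[rotated]) (use bound in simp)
  then have "(\<lambda>j. x (j + k)) \<longlonglongrightarrow> y"
    using LIM_zero_iff[of "\<lambda>j. x (j + k)" y] by blast
  then show ?thesis by (rule LIMSEQ_offset)
qed

lemma isCont_eventually_less:
  fixes h :: "'a::t2_space \<Rightarrow> real"
  assumes "isCont h y"
  shows "h y < c \<Longrightarrow> \<forall>\<^sub>F x in nhds y. h x < c"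
    and "c < h y \<Longrightarrow> \<forall>\<^sub>F x in nhds y. c < h x"
  using assms order_tendstoD[of h "h y" "nhds y" c]
  by (auto simp: isCont_def tendsto_at_iff_tendsto_nhds)

section \<open>Stationarity of the accumulation point\<close>

context regularized_newton
begin

lemma phase1_step_descent:
  assumes \<mu>: "\<mu> \<in> {0<..<1}" and \<alpha>: "\<alpha> \<in> {0<..<1}" and g: "g x \<noteq> 0"
  shows "f (phase1_step f \<mu> \<alpha> x) \<le> f x"
proof -
  have s: "0 < g x \<bullet> g x" using g by simp
  obtain \<kappa> where "0 < \<kappa>" "\<And>z p. \<lbrakk>norm z \<le> norm x; norm p \<le> norm (g x); f z \<le> f x; g z \<bullet> p \<le> - (g x \<bullet> g x)\<rbrakk>
      \<Longrightarrow> f (z + armijo_step f \<mu> \<alpha> z p (g z \<bullet> p) *\<^sub>R p) \<le> f z - \<kappa>"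
    using armijo_uniform_decrease[OF \<mu> \<alpha> s norm_ge_zero norm_ge_zero objective_nonneg] by metis
  from this(1) this(2)[of x "- g x"] show ?thesis
    unfolding phase1_step_eq by simp
qed

lemma phase2_step_descent:
  assumes \<mu>: "\<mu> \<in> {0<..<1}" and \<alpha>: "\<alpha> \<in> {0<..<1}" and g: "g x \<noteq> 0"
  shows "f (phase2_step n A b \<beta> \<delta> \<mu> \<alpha> x) \<le> f x"
proof -
  have x: "x \<noteq> 0" using g by (rule nonzero_if_grad_nonzero)
  have "d x \<noteq> 0" using newton_dir_lower[OF x] g by auto
  then have "0 < 2 * lam * (norm x)\<^sup>2 * (norm (d x))\<^sup>2" using x lam_pos by simp
  with newton_slope[OF x] have s: "0 < - (g x \<bullet> d x)" by linarith
  obtain \<kappa> where "0 < \<kappa>" "\<And>z p. \<lbrakk>norm z \<le> norm x; norm p \<le> norm (d x); f z \<le> f x; g z \<bullet> p \<le> - (- (g x \<bullet> d x))\<rbrakk>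
      \<Longrightarrow> f (z + armijo_step f \<mu> \<alpha> z p (g z \<bullet> p) *\<^sub>R p) \<le> f z - \<kappa>"
    using armijo_uniform_decrease[OF \<mu> \<alpha> s norm_ge_zero norm_ge_zero objective_nonneg] by metis
  from this(1) this(2)[of x "d x"] show ?thesis
    unfolding phase2_step_eq by simp
qed

text \<open>Continuity of \<open>g\<close> and of the norm gives common bounds for all starting points near \<open>y\<close>. The gradient step has
  slope \<open>- \<parallel>g x\<parallel>\<^sup>2\<close>; the Newton step has slope at most \<open>- 2 lam \<parallel>x\<parallel>\<^sup>2 \<parallel>d x\<parallel>\<^sup>2\<close> with \<open>\<parallel>d x\<parallel>\<close> bounded
  from both sides.\<close>

lemma decrease_near_nonstationary:
  assumes "\<mu>1 \<in> {0<..<1}" "\<alpha>1 \<in> {0<..<1}" "\<mu>2 \<in> {0<..<1}" "\<alpha>2 \<in> {0<..<1}"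
    and y: "g y \<noteq> 0"
  obtains \<kappa> where "0 < \<kappa>"
    and "\<forall>\<^sub>F x in nhds y. f (phase1_step f \<mu>1 \<alpha>1 x) \<le> f x - \<kappa> \<and>
      f (phase2_step n A b \<beta> \<delta> \<mu>2 \<alpha>2 x) \<le> f x - \<kappa>"
proof -
  define \<Gamma> where "\<Gamma> = norm (g y)"
  \<comment> \<open>\<open>T\<close> bounds the norm of the Newton matrix, \<open>D\<close> the length of the Newton direction, and \<open>- s\<close> the Newton
    slope.\<close>
  define T where "T = 2 * \<eta> * (norm y + 1)\<^sup>2 + \<beta> * (\<Gamma> + 1) powr \<delta>"
  define D where "D = (\<Gamma> + 1) / (lam * (norm y)\<^sup>2)"
  define s where "s = lam * (norm y)\<^sup>2 * (\<Gamma> / 2 / T)\<^sup>2"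
  have y0: "y \<noteq> 0" using y by (rule nonzero_if_grad_nonzero)
  have \<Gamma>: "0 < \<Gamma>" using y by (simp add: \<Gamma>_def)
  have "0 < norm y + 1" by (simp add: add_nonneg_pos)
  then have T: "0 < T"
    unfolding T_def using eta_pos \<beta> by (intro add_pos_nonneg mult_pos_pos) auto
  have ly: "0 < lam * (norm y)\<^sup>2" using y0 lam_pos by simp
  have D: "0 \<le> D" using ly \<Gamma> by (simp add: D_def)
  have s: "0 < s" unfolding s_def using ly \<Gamma> T by simp
  have R: "0 \<le> norm y + 1" and \<Gamma>1: "0 \<le> \<Gamma> + 1" and F: "0 \<le> f y + 1" and s1: "0 < (\<Gamma> / 2)\<^sup>2"
    using \<Gamma> objective_nonneg[of y] by auto
  obtain \<kappa>1 where \<kappa>1: "0 < \<kappa>1" and dec1: "\<And>z p. \<lbrakk>norm z \<le> norm y + 1; norm p \<le> \<Gamma> + 1; f z \<le> f y + 1;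
      g z \<bullet> p \<le> - (\<Gamma> / 2)\<^sup>2\<rbrakk> \<Longrightarrow> f (z + armijo_step f \<mu>1 \<alpha>1 z p (g z \<bullet> p) *\<^sub>R p) \<le> f z - \<kappa>1"
    using armijo_uniform_decrease[OF assms(1,2) s1 R \<Gamma>1 F] by metis
  obtain \<kappa>2 where \<kappa>2: "0 < \<kappa>2" and dec2: "\<And>z p. \<lbrakk>norm z \<le> norm y + 1; norm p \<le> D; f z \<le> f y + 1;
      g z \<bullet> p \<le> - s\<rbrakk> \<Longrightarrow> f (z + armijo_step f \<mu>2 \<alpha>2 z p (g z \<bullet> p) *\<^sub>R p) \<le> f z - \<kappa>2"
    using armijo_uniform_decrease[OF assms(3,4) s R D F] by metis
  have cg: "isCont (\<lambda>x. norm (g x)) y"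
    by (intro continuous_norm continuous_g)
  have cn: "isCont norm y" and cn2: "isCont (\<lambda>x. (norm x)\<^sup>2) y"
    by (intro continuous_intros)+
  have "\<forall>\<^sub>F x in nhds y. norm x < norm y + 1"
    by (rule isCont_eventually_less[OF cn]) simp
  moreover have "\<forall>\<^sub>F x in nhds y. (norm y)\<^sup>2 / 2 < (norm x)\<^sup>2"
    using y0 by (intro isCont_eventually_less[OF cn2]) simp
  moreover have "\<forall>\<^sub>F x in nhds y. f x < f y + 1"
    by (rule isCont_eventually_less[OF continuous_objective]) simp
  moreover have "\<forall>\<^sub>F x in nhds y. norm (g x) < \<Gamma> + 1"
    by (rule isCont_eventually_less[OF cg]) (simp add: \<Gamma>_def)
  moreover have "\<forall>\<^sub>F x in nhds y. \<Gamma> / 2 < norm (g x)"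
    using \<Gamma> by (intro isCont_eventually_less[OF cg]) (simp add: \<Gamma>_def)
  ultimately have "\<forall>\<^sub>F x in nhds y. f (phase1_step f \<mu>1 \<alpha>1 x) \<le> f x - min \<kappa>1 \<kappa>2 \<and>
      f (phase2_step n A b \<beta> \<delta> \<mu>2 \<alpha>2 x) \<le> f x - min \<kappa>1 \<kappa>2"
  proof eventually_elim
    case (elim x)
    have x0: "x \<noteq> 0" using elim(2) by auto
    have gx: "(\<Gamma> / 2)\<^sup>2 \<le> g x \<bullet> g x"
      unfolding dot_square_norm using elim \<Gamma> by (intro power_mono) auto
    have 1: "f (phase1_step f \<mu>1 \<alpha>1 x) \<le> f x - \<kappa>1"
      unfolding phase1_step_eq using elim gx by (intro dec1) auto
    have ylx: "lam * (norm y)\<^sup>2 \<le> 2 * lam * (norm x)\<^sup>2"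
      using elim(2) lam_pos by simp
    have "lam * (norm y)\<^sup>2 * norm (d x) \<le> 2 * lam * (norm x)\<^sup>2 * norm (d x)"
      by (intro mult_right_mono ylx) simp
    with newton_dir_upper[OF x0] elim have dD: "norm (d x) \<le> D"
      unfolding D_def using ly by (simp add: pos_le_divide_eq mult.commute)
    have "2 * \<eta> * (norm x)\<^sup>2 + \<rho> x \<le> T"
      unfolding T_def using elim eta_pos \<beta> \<delta>
      by (intro add_mono mult_left_mono power_mono powr_mono2) auto
    then have "(2 * \<eta> * (norm x)\<^sup>2 + \<rho> x) * norm (d x) \<le> T * norm (d x)"
      by (intro mult_right_mono) auto
    with newton_dir_lower[OF x0] elim(5) have "\<Gamma> / 2 \<le> norm (d x) * T"
      by (simp add: mult.commute)
    then have "\<Gamma> / 2 / T \<le> norm (d x)"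
      using T by (simp add: pos_divide_le_eq)
    then have "(\<Gamma> / 2 / T)\<^sup>2 \<le> (norm (d x))\<^sup>2"
      using \<Gamma> T by (intro power_mono) auto
    then have "s \<le> 2 * lam * (norm x)\<^sup>2 * (norm (d x))\<^sup>2"
      unfolding s_def using lam_pos by (intro mult_mono[OF ylx]) auto
    with newton_slope[OF x0] have "g x \<bullet> d x \<le> - s" by linarith
    then have 2: "f (phase2_step n A b \<beta> \<delta> \<mu>2 \<alpha>2 x) \<le> f x - \<kappa>2"
      unfolding phase2_step_eq using elim dD by (intro dec2) auto
    from 1 2 show ?case by linarith
  qed
  moreover have "0 < min \<kappa>1 \<kappa>2" using \<kappa>1 \<kappa>2 by simp
  ultimately show ?thesis using that by blast
qed

lemma accumulation_point_stationary:
  assumes par: "\<mu>1 \<in> {0<..<1}" "\<alpha>1 \<in> {0<..<1}" "\<mu>2 \<in> {0<..<1}" "\<alpha>2 \<in> {0<..<1}"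
    and step: "\<And>k. x (Suc k) = phase1_step f \<mu>1 \<alpha>1 (x k) \<or> x (Suc k) = phase2_step n A b \<beta> \<delta> \<mu>2 \<alpha>2 (x k)"
    and nonstat: "\<And>k. g (x k) \<noteq> 0"
    and acc: "accumulation_point x y"
  shows "g y = 0"
proof (rule ccontr)
  assume "g y \<noteq> 0"
  then obtain \<kappa> where "0 < \<kappa>" and "\<forall>\<^sub>F x in nhds y. f (phase1_step f \<mu>1 \<alpha>1 x) \<le> f x - \<kappa> \<and>
      f (phase2_step n A b \<beta> \<delta> \<mu>2 \<alpha>2 x) \<le> f x - \<kappa>"
    by (rule decrease_near_nonstationary[OF par])
  from accumulation_point_frequently[OF acc this(2)]
  have "\<exists>\<^sub>F k in sequentially. f (x (Suc k)) \<le> f (x k) - \<kappa>"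
  proof (rule frequently_elim1)
    fix k
    assume "f (phase1_step f \<mu>1 \<alpha>1 (x k)) \<le> f (x k) - \<kappa> \<and>
      f (phase2_step n A b \<beta> \<delta> \<mu>2 \<alpha>2 (x k)) \<le> f (x k) - \<kappa>"
    then show "f (x (Suc k)) \<le> f (x k) - \<kappa>"
      using step[of k] by auto
  qed
  moreover have "decseq (\<lambda>k. f (x k))"
  proof (rule decseq_SucI)
    fix k show "f (x (Suc k)) \<le> f (x k)"
      using step[of k] phase1_step_descent[OF par(1,2) nonstat[of k]]
        phase2_step_descent[OF par(3,4) nonstat[of k]] by auto
  qed
  ultimately show False
    using no_frequent_decrease[of "\<lambda>k. f (x k)" \<kappa>] objective_nonneg \<open>0 < \<kappa>\<close> by blast
qed

section \<open>Local behaviour at a stationary point\<close>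

text \<open>The slope is \<open>- \<langle>d, H x d\<rangle> - \<rho> \<parallel>d\<parallel>\<^sup>2\<close>, so by the exact expansion the Armijo inequality for step size
  one says that \<open>\<langle>d, B x d\<rangle>/2\<close> plus terms of order three and four in \<open>d\<close> is at most
  \<open>(1/2 - \<mu>) \<langle>d, H x d\<rangle> + (1 - \<mu>) \<rho> \<parallel>d\<parallel>\<^sup>2\<close>. Divided by \<open>\<parallel>d\<parallel>\<^sup>2\<close>, it is strict in the limit \<open>x \<rightarrow> y\<close>
  by the assumption on \<open>B y\<close>, since \<open>d x \<rightarrow> 0\<close>.\<close>

lemma unit_step_accepted:
  assumes y: "g y = 0" "y \<noteq> 0" and \<mu>: "\<mu> \<in> {0<..<1/2}"
    and small: "spectral_norm (B y) < 2 * (1 - 2 * \<mu>) * lam * (norm y)\<^sup>2"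
  shows "\<forall>\<^sub>F x in nhds y. x \<noteq> 0 \<longrightarrow> f (x + d x) \<le> f x + \<mu> * (g x \<bullet> d x)"
proof -
  \<comment> \<open>\<open>D x\<close> is a continuous bound for the length of the Newton direction with \<open>D y = 0\<close>, and \<open>E x < 0\<close> is a sufficient
    condition for acceptance at \<open>x\<close>.\<close>
  define D where "D x = norm (g x) / (2 * lam * (norm x)\<^sup>2)" for x
  define E where "E x = spectral_norm (B y) / 2 + \<eta> * norm (x - y) * norm (x + y) / 2
      + \<eta> * norm x * D x + \<eta> * (D x)\<^sup>2 / 4 - (1 - 2 * \<mu>) * lam * (norm x)\<^sup>2" for x
  have "isCont D y"
    unfolding D_def using y lam_pos by (intro continuous_intros continuous_g) auto
  then have "isCont E y"
    unfolding E_def by (intro continuous_intros) auto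
  moreover have "E y < 0"
    using small y by (simp add: E_def D_def algebra_simps)
  ultimately have "\<forall>\<^sub>F x in nhds y. E x < 0"
    by (rule isCont_eventually_less)
  then show ?thesis
  proof (rule eventually_mono, intro impI)
    fix x assume Ex: "E x < 0" and x: "x \<noteq> 0"
    define v where "v = d x"
    let ?p = "\<lambda>i. v \<bullet> (A i *v x)" and ?q = "\<lambda>i. v \<bullet> (A i *v v)"
    have vD: "norm v \<le> D x"
      unfolding D_def v_def using newton_dir_upper[OF x] x lam_pos
      by (simp add: pos_le_divide_eq mult.commute)
    have "\<phi> i x = \<phi> i y + (x - y) \<bullet> (A i *v (x + y))" if "i \<in> {1..n}" for i
      using form_sym[OF that, of x y]
      by (simp add: residual_def matrix_vector_right_distrib inner_diff_left inner_add_right)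
    then have "v \<bullet> (B x *v v) = mean (\<lambda>i. \<phi> i y * ?q i + ((x - y) \<bullet> (A i *v (x + y))) * ?q i)"
      unfolding inner_B by (intro mean_cong) (simp only: distrib_right)
    also have "\<dots> = v \<bullet> (B y *v v) + mean (\<lambda>i. ((x - y) \<bullet> (A i *v (x + y))) * ?q i)"
      unfolding mean_add inner_B ..
    also have "\<dots> \<le> spectral_norm (B y) * norm v * norm v
        + \<eta> * norm (x - y) * norm (x + y) * norm v * norm v"
      using inner_mult_le_spectral_norm[of v "B y" v] mean_form_bound[of "x - y" "x + y" v v]
      by linarith
    finally have Bx: "v \<bullet> (B x *v v) \<le>
        (spectral_norm (B y) + \<eta> * norm (x - y) * norm (x + y)) * (norm v)\<^sup>2"
      by (simp add: power2_eq_square algebra_simps)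
    have "mean (\<lambda>i. ?p i * ?q i) \<le> \<eta> * norm v * norm x * norm v * norm v"
      using mean_form_bound[of v x v v] by linarith
    also have "\<dots> = \<eta> * norm x * norm v * (norm v)\<^sup>2"
      by (simp add: power2_eq_square)
    also have "\<dots> \<le> \<eta> * norm x * D x * (norm v)\<^sup>2"
      using vD eta_pos by (intro mult_right_mono mult_left_mono) auto
    finally have pq: "mean (\<lambda>i. ?p i * ?q i) \<le> \<eta> * norm x * D x * (norm v)\<^sup>2" .
    have "mean (\<lambda>i. (?q i)\<^sup>2) \<le> \<eta> * (norm v)\<^sup>2 * (norm v)\<^sup>2"
      by (rule mean_form_upper)
    also have "\<dots> \<le> \<eta> * (D x)\<^sup>2 * (norm v)\<^sup>2"
      using vD eta_pos by (intro mult_right_mono mult_left_mono power_mono) auto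
    finally have q2: "mean (\<lambda>i. (?q i)\<^sup>2) \<le> \<eta> * (D x)\<^sup>2 * (norm v)\<^sup>2" .
    have slope: "g x \<bullet> v = - (v \<bullet> (H x *v v)) - \<rho> x * (norm v)\<^sup>2"
      using newton_inner[OF x, of v]
      by (simp add: v_def inner_commute[of "g x"] power2_norm_eq_inner)
    have damp: "0 \<le> (1 - \<mu>) * (\<rho> x * (norm v)\<^sup>2)"
      using \<mu> \<beta> by auto
    have curv: "(1 - 2 * \<mu>) * (2 * lam * (norm x)\<^sup>2 * (norm v)\<^sup>2) \<le> (1 - 2 * \<mu>) * (v \<bullet> (H x *v v))"
      using \<mu> by (intro mult_left_mono H_lower) auto
    have "E x * (norm v)\<^sup>2 = (spectral_norm (B y) + \<eta> * norm (x - y) * norm (x + y)) * (norm v)\<^sup>2 / 2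
        + \<eta> * norm x * D x * (norm v)\<^sup>2 + \<eta> * (D x)\<^sup>2 * (norm v)\<^sup>2 / 4
        - (1 - 2 * \<mu>) * (2 * lam * (norm x)\<^sup>2 * (norm v)\<^sup>2) / 2"
      by (simp add: E_def field_simps)
    moreover have "E x * (norm v)\<^sup>2 \<le> 0"
      using Ex by (intro mult_nonpos_nonneg) auto
    ultimately have "(spectral_norm (B y) + \<eta> * norm (x - y) * norm (x + y)) * (norm v)\<^sup>2 / 2
        + \<eta> * norm x * D x * (norm v)\<^sup>2 + \<eta> * (D x)\<^sup>2 * (norm v)\<^sup>2 / 4
        \<le> (1 - 2 * \<mu>) * (2 * lam * (norm x)\<^sup>2 * (norm v)\<^sup>2) / 2"
      by linarith
    moreover have "(v \<bullet> (B x *v v)) / 2 + mean (\<lambda>i. ?p i * ?q i) + mean (\<lambda>i. (?q i)\<^sup>2) / 4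
        \<le> (spectral_norm (B y) + \<eta> * norm (x - y) * norm (x + y)) * (norm v)\<^sup>2 / 2
        + \<eta> * norm x * D x * (norm v)\<^sup>2 + \<eta> * (D x)\<^sup>2 * (norm v)\<^sup>2 / 4"
      using Bx pq q2 by (intro add_mono divide_right_mono) auto
    moreover have "(1 - 2 * \<mu>) * (2 * lam * (norm x)\<^sup>2 * (norm v)\<^sup>2) / 2
        \<le> (1 - 2 * \<mu>) * (v \<bullet> (H x *v v)) / 2"
      using curv by (intro divide_right_mono) auto
    ultimately have "(v \<bullet> (B x *v v)) / 2 + mean (\<lambda>i. ?p i * ?q i) + mean (\<lambda>i. (?q i)\<^sup>2) / 4
        \<le> (1 - 2 * \<mu>) * (v \<bullet> (H x *v v)) / 2"
      by (meson order_trans)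
    moreover have "f x + \<mu> * (g x \<bullet> v) - f (x + v) = (1 - 2 * \<mu>) * (v \<bullet> (H x *v v)) / 2
        + (1 - \<mu>) * (\<rho> x * (norm v)\<^sup>2)
        - ((v \<bullet> (B x *v v)) / 2 + mean (\<lambda>i. ?p i * ?q i) + mean (\<lambda>i. (?q i)\<^sup>2) / 4)"
      unfolding objective_expand[of x v] inner_commute[of v "g x"] slope
      by (simp add: field_simps)
    ultimately show "f (x + d x) \<le> f x + \<mu> * (g x \<bullet> d x)"
      using damp unfolding v_def by linarith
  qed
qed

text \<open>This is \<open>newton_error\<close> near \<open>y\<close>, where \<open>\<rho> x \<le> \<beta> (G \<parallel>x - y\<parallel>)\<^sup>\<delta>\<close> because \<open>g\<close> vanishes at \<open>y\<close>. The neighbourhood is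
  chosen such that \<open>\<parallel>x\<parallel>\<^sup>2 > 4/5 \<parallel>y\<parallel>\<^sup>2\<close>: the factor \<open>5/8\<close> instead of the limiting \<open>1/2\<close> still
  yields \<open>5/8 * 2/5 = 1/4\<close> when \<open>\<parallel>B y\<parallel> \<le> 2/5 lam \<parallel>y\<parallel>\<^sup>2\<close>.\<close>

lemma newton_local_error:
  assumes y: "g y = 0" "y \<noteq> 0"
  obtains c1 c2 where "0 < c1" "0 < c2"
    and "\<forall>\<^sub>F x in nhds y. norm (x + d x - y) \<le> c1 * (norm (x - y))\<^sup>2 + c2 * norm (x - y) powr (1 + \<delta>)
      + 5 * spectral_norm (B y) / (8 * lam * (norm y)\<^sup>2) * norm (x - y)"
proof -
  define \<sigma> where "\<sigma> = spectral_norm (B y)"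
  define G where "G = 2 * \<eta> * (2 * norm y)\<^sup>2 + \<sigma> + \<eta> * (2 * norm y) * 1"
  define P where "P = 8 * lam * (norm y)\<^sup>2 / 5"
  have \<sigma>: "0 \<le> \<sigma>" by (simp add: \<sigma>_def spectral_norm_nonneg)
  have P: "0 < P" using y lam_pos by (simp add: P_def)
  have G: "0 < G" using y eta_pos \<sigma> by (simp add: G_def add_pos_nonneg add_pos_pos)
  have cn: "isCont norm y" and cn2: "isCont (\<lambda>x. (norm x)\<^sup>2) y" and ce: "isCont (\<lambda>x. norm (x - y)) y"
    by (intro continuous_intros)+
  have "\<forall>\<^sub>F x in nhds y. norm x < 2 * norm y"
    using y by (intro isCont_eventually_less[OF cn]) simp
  moreover have "\<forall>\<^sub>F x in nhds y. 4 / 5 * (norm y)\<^sup>2 < (norm x)\<^sup>2"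
    using y by (intro isCont_eventually_less[OF cn2]) simp
  moreover have "\<forall>\<^sub>F x in nhds y. norm (x - y) < 1"
    by (intro isCont_eventually_less[OF ce]) simp
  ultimately have "\<forall>\<^sub>F x in nhds y. norm (x + d x - y)
      \<le> (2 * \<eta> * norm y / P) * (norm (x - y))\<^sup>2 + (\<beta> * G powr \<delta> / P) * norm (x - y) powr (1 + \<delta>)
        + 5 * \<sigma> / (8 * lam * (norm y)\<^sup>2) * norm (x - y)"
  proof eventually_elim
    case (elim x)
    define e where "e = norm (x - y)"
    have e: "0 \<le> e" "e \<le> 1" using elim by (auto simp: e_def)
    have x: "x \<noteq> 0" using elim(2) by auto
    have "norm (g x) \<le> (2 * \<eta> * (norm x)\<^sup>2 + \<sigma> + \<eta> * norm x * e) * e"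
      unfolding e_def \<sigma>_def by (rule g_bound[OF y(1)])
    also have "\<dots> \<le> G * e"
      unfolding G_def using elim e eta_pos
      by (intro mult_right_mono add_mono mult_mono power_mono) auto
    finally have "norm (g x) powr \<delta> \<le> (G * e) powr \<delta>"
      using \<delta> by (intro powr_mono2) auto
    then have \<rho>: "\<rho> x \<le> \<beta> * G powr \<delta> * e powr \<delta>"
      using \<beta> e G by (simp add: powr_mult mult.assoc)
    have "P * norm (x + d x - y) \<le> 2 * lam * (norm x)\<^sup>2 * norm (x + d x - y)"
      unfolding P_def using elim(2) lam_pos by (intro mult_right_mono) auto
    also have "\<dots> \<le> (\<rho> x + \<sigma>) * e + \<eta> * norm x * e\<^sup>2"
      unfolding e_def \<sigma>_def by (rule newton_error[OF x y(1)])
    also have "\<dots> \<le> (\<beta> * G powr \<delta> * e powr \<delta> + \<sigma>) * e + \<eta> * (2 * norm y) * e\<^sup>2"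
      using elim e eta_pos \<rho> by (intro add_mono mult_right_mono mult_left_mono) auto
    also have "\<dots> = \<beta> * G powr \<delta> * e powr (1 + \<delta>) + \<sigma> * e + 2 * \<eta> * norm y * e\<^sup>2"
      using e by (simp add: powr_add algebra_simps)
    finally have "norm (x + d x - y)
        \<le> (\<beta> * G powr \<delta> * e powr (1 + \<delta>) + \<sigma> * e + 2 * \<eta> * norm y * e\<^sup>2) / P"
      using P by (simp add: pos_le_divide_eq mult.commute)
    also have "\<dots> = (2 * \<eta> * norm y / P) * e\<^sup>2 + (\<beta> * G powr \<delta> / P) * e powr (1 + \<delta>) + \<sigma> / P * e"
      by (simp add: add_divide_distrib)
    also have "\<sigma> / P = 5 * \<sigma> / (8 * lam * (norm y)\<^sup>2)"
      by (simp add: P_def)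
    finally show ?case unfolding e_def .
  qed
  moreover have "0 < 2 * \<eta> * norm y / P" "0 < \<beta> * G powr \<delta> / P"
    using y eta_pos P \<beta> G by simp_all
  ultimately show ?thesis using that unfolding \<sigma>_def by blast
qed

lemma superlinear_term_small:
  assumes "0 < \<epsilon>" 
  shows "\<forall>\<^sub>F x in nhds y. c1 * (norm (x - y))\<^sup>2 + c2 * norm (x - y) powr (1 + \<delta>) \<le> \<epsilon> * norm (x - y)"
proof -
  have "((\<lambda>x. norm (x - y)) \<longlongrightarrow> norm (y - y)) (nhds y)"
    by (intro tendsto_norm tendsto_diff tendsto_const filterlim_ident)
  then have e: "((\<lambda>x. norm (x - y)) \<longlongrightarrow> 0) (nhds y)" by simp
  have "((\<lambda>x. c1 * norm (x - y) + c2 * norm (x - y) powr \<delta>) \<longlongrightarrow> c1 * 0 + c2 * 0 powr \<delta>) (nhds y)"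
    using \<delta> by (intro tendsto_add tendsto_mult tendsto_const e tendsto_powr') auto
  then have "\<forall>\<^sub>F x in nhds y. c1 * norm (x - y) + c2 * norm (x - y) powr \<delta> < \<epsilon>"
    using assms by (intro order_tendstoD(2)) auto
  then show ?thesis
  proof (rule eventually_mono)
    fix x assume "c1 * norm (x - y) + c2 * norm (x - y) powr \<delta> < \<epsilon>"
    then have "(c1 * norm (x - y) + c2 * norm (x - y) powr \<delta>) * norm (x - y) \<le> \<epsilon> * norm (x - y)"
      by (intro mult_right_mono) auto
    then show "c1 * (norm (x - y))\<^sup>2 + c2 * norm (x - y) powr (1 + \<delta>) \<le> \<epsilon> * norm (x - y)"
      by (simp add: powr_add power2_eq_square algebra_simps)
  qed
qed

end

section \<open>Convergence of the regularized Newton method\<close>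

text \<open>The first bound is \<open>5 - 4\<mu>\<^sup>2 < 5\<close>. The second amounts to \<open>\<mu> (5 - 4\<mu>\<^sup>2) < 2\<close>, which holds because
  \<open>2 - 5\<mu> + 4\<mu>\<^sup>3 = (1 - 2\<mu>) (2 - \<mu> - 2\<mu>\<^sup>2)\<close> is positive.\<close>

lemma residual_threshold_bounds:
  fixes \<mu> :: real
  assumes "\<mu> \<in> {0<..<1/2}"
  defines "c \<equiv> 2 - 8 / (5 - 4 * \<mu>\<^sup>2)"
  shows "c < 2/5" and "c < 2 * (1 - 2 * \<mu>)"
proof -
  have \<mu>: "0 < \<mu>" "\<mu> < 1/2" using assms by auto
  have sq: "0 < \<mu>\<^sup>2" using \<mu> by simp
  have "\<mu>\<^sup>2 < (1/2)\<^sup>2" using \<mu> by (intro power_strict_mono) auto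
  then have den: "0 < 5 - 4 * \<mu>\<^sup>2" by (simp add: power2_eq_square)
  then show "c < 2/5"
    unfolding c_def using sq by (simp add: field_simps)
  have "\<mu>\<^sup>2 < 1/4" using \<open>\<mu>\<^sup>2 < (1/2)\<^sup>2\<close> by (simp add: power2_eq_square)
  then have "0 < 2 - \<mu> - 2 * \<mu>\<^sup>2" using \<mu> by linarith
  then have "0 < (1 - 2 * \<mu>) * (2 - \<mu> - 2 * \<mu>\<^sup>2)" using \<mu> by (intro mult_pos_pos) auto
  then have "4 * \<mu> * (5 - 4 * \<mu>\<^sup>2) < 8"
    by (simp add: algebra_simps power2_eq_square)
  then have "4 * \<mu> < 8 / (5 - 4 * \<mu>\<^sup>2)"
    using den by (simp add: pos_less_divide_eq)
  then show "c < 2 * (1 - 2 * \<mu>)"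
    unfolding c_def by simp
qed

lemma phase1_exit_exists:
  assumes "\<not> phase1_guard F \<epsilon>G K0 x k"
  obtains K where "K \<le> k" and "phase1_exit F \<epsilon>G K0 x K"
  using not_less_Least[where P = "\<lambda>k. \<not> phase1_guard F \<epsilon>G K0 x k"]
  using LeastI[where P = "\<lambda>k. \<not> phase1_guard F \<epsilon>G K0 x k", OF assms]
    Least_le[where P = "\<lambda>k. \<not> phase1_guard F \<epsilon>G K0 x k", OF assms]
  unfolding phase1_exit_def by blast

lemma GRNM_step_cases:
  assumes "GRNM n A b \<epsilon>G \<beta> K0 \<mu>1 \<mu>2 \<alpha>1 \<alpha>2 \<delta> x"
  shows "x (Suc k) = phase1_step (objective n A b) \<mu>1 \<alpha>1 (x k) \<or>
    x (Suc k) = phase2_step n A b \<beta> \<delta> \<mu>2 \<alpha>2 (x k)"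
proof (cases "\<forall>j\<le>k. phase1_guard (objective n A b) \<epsilon>G K0 x j")
  case True
  then show ?thesis using assms by (simp add: GRNM_def Let_def)
next
  case False
  then obtain j where "j \<le> k" "\<not> phase1_guard (objective n A b) \<epsilon>G K0 x j" by blast
  then obtain K where "phase1_exit (objective n A b) \<epsilon>G K0 x K" "K \<le> k"
    using phase1_exit_exists order_trans by metis
  then show ?thesis using assms by (simp add: GRNM_def Let_def)
qed

text \<open>Iterates close to the stationary point \<open>y\<close> have gradients below the tolerance, and there are such
  iterates beyond index \<open>K0\<close>.\<close>

lemma (in quadratic_measurements) phase1_terminates:
  assumes acc: "accumulation_point x y" and y: "g y = 0" and "0 < \<epsilon>G"
  obtains K where "phase1_exit f \<epsilon>G K0 x K"
proof -
  have "isCont (\<lambda>x. norm (g x)) y"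
    by (intro continuous_norm continuous_g)
  then have "\<forall>\<^sub>F z in nhds y. norm (g z) < \<epsilon>G"
    using y \<open>0 < \<epsilon>G\<close> by (intro isCont_eventually_less) auto
  from accumulation_point_frequently[OF acc this]
  obtain k where "k \<ge> Suc K0" "norm (g (x k)) < \<epsilon>G"
    unfolding frequently_sequentially by blast
  then have "\<not> phase1_guard f \<epsilon>G K0 x k"
    by (simp add: phase1_guard_def)
  then show ?thesis
    using phase1_exit_exists that by metis
qed

theorem theorem4p2:
  fixes n :: nat
    and A :: "nat \<Rightarrow> real^'p^'p"
    and xs :: "real^'p"
    and \<epsilon> b :: "nat \<Rightarrow> real"
    and lam \<eta> \<epsilon>G \<beta> \<mu>1 \<mu>2 \<alpha>1 \<alpha>2 \<delta> :: real
    and K0 :: nat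
    and x :: "nat \<Rightarrow> real^'p"
    and xbar :: "real^'p"
  assumes "n \<ge> 1"
    and "\<And>i. i \<in> {1..n} \<Longrightarrow> transpose (A i) = A i"
    and "b = observation A xs \<epsilon>"
    and "lam > 0" and "\<eta> > 0"
    and "\<And>u v. lam * (norm u)\<^sup>2 * (norm v)\<^sup>2 \<le> 1 / real n * (\<Sum>i=1..n. (u \<bullet> (A i *v v))\<^sup>2)"
    and "\<And>u v. 1 / real n * (\<Sum>i=1..n. (u \<bullet> (A i *v v))\<^sup>2) \<le> \<eta> * (norm u)\<^sup>2 * (norm v)\<^sup>2"
    and "\<epsilon>G > 0" and "\<beta> > 0"
    and "\<mu>1 \<in> {0<..<1}" and "\<mu>2 \<in> {0<..<1/2}"
    and "\<alpha>1 \<in> {0<..<1}" and "\<alpha>2 \<in> {0<..<1}" and "\<delta> \<in> {0<..<1}"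
    and "GRNM n A b \<epsilon>G \<beta> K0 \<mu>1 \<mu>2 \<alpha>1 \<alpha>2 \<delta> x"
    and "\<And>k. grad (objective n A b) (x k) \<noteq> 0"
    and "accumulation_point x xbar" and "xbar \<noteq> 0"
    and "spectral_norm (residual_matrix n A b xbar)
           \<le> (2 - 8 / (5 - 4 * \<mu>2\<^sup>2)) * lam * (norm xbar)\<^sup>2"
  shows "(\<exists>K. phase1_exit (objective n A b) \<epsilon>G K0 x K \<and>
           (\<exists>c1>0. \<exists>c2>0. \<exists>c3. 0 < c3 \<and> c3 < 1/2 \<and>
             (\<exists>N. \<forall>k\<ge>N. k > K \<longrightarrow>
                norm (x (Suc k) - xbar)
                  \<le> c1 * (norm (x k - xbar))\<^sup>2 + c2 * norm (x k - xbar) powr (1 + \<delta>)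
                      + c3 * norm (x k - xbar)))) \<and>
         ((\<forall>i\<in>{1..n}. residual A b i xbar = 0) \<longrightarrow> converges_with_rate x xbar (1 + \<delta>))"
proof -
  interpret regularized_newton n A b lam \<eta> \<beta> \<delta>
    by unfold_locales (use assms in auto)
  let ?y = xbar
  define c where "c = 2 - 8 / (5 - 4 * \<mu>2\<^sup>2)"
  define \<sigma> where "\<sigma> = spectral_norm (B ?y)"
  have c: "c < 2/5" "c < 2 * (1 - 2 * \<mu>2)"
    unfolding c_def by (rule residual_threshold_bounds[OF assms(11)])+
  have ly: "0 < lam * (norm ?y)\<^sup>2"
    using assms(4,18) by simp
  have \<sigma>: "\<sigma> \<le> c * (lam * (norm ?y)\<^sup>2)"
    using assms(19) by (simp add: \<sigma>_def c_def mult.assoc)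
  have \<mu>2: "\<mu>2 \<in> {0<..<1}"
    using assms(11) by auto
  have y: "g ?y = 0"
    by (rule accumulation_point_stationary[OF assms(10,12) \<mu>2 assms(13)
        GRNM_step_cases[OF assms(15)] assms(16,17)])
  obtain K where K: "phase1_exit f \<epsilon>G K0 x K"
    by (rule phase1_terminates[OF assms(17) y assms(8)])
  have phase2: "x (Suc k) = phase2_step n A b \<beta> \<delta> \<mu>2 \<alpha>2 (x k)" if "k \<ge> K" for k
    using assms(15) K that by (simp add: GRNM_def Let_def)
  have x0: "x k \<noteq> 0" for k
    by (rule nonzero_if_grad_nonzero) (rule assms(16))
  have "\<sigma> < 2 * (1 - 2 * \<mu>2) * (lam * (norm ?y)\<^sup>2)"
    using \<sigma> mult_strict_right_mono[OF c(2) ly] by linarith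
  then have accepted: "\<forall>\<^sub>F z in nhds ?y. z \<noteq> 0 \<longrightarrow> f (z + d z) \<le> f z + \<mu>2 * (g z \<bullet> d z)"
    by (intro unit_step_accepted[OF y assms(18,11)]) (simp add: \<sigma>_def mult.assoc)
  obtain c1 c2 where c12: "0 < c1" "0 < c2"
    and error: "\<forall>\<^sub>F z in nhds ?y. norm (z + d z - ?y) \<le> c1 * (norm (z - ?y))\<^sup>2
      + c2 * norm (z - ?y) powr (1 + \<delta>) + 5 * \<sigma> / (8 * lam * (norm ?y)\<^sup>2) * norm (z - ?y)"
    unfolding \<sigma>_def by (rule newton_local_error[OF y assms(18)])
  define q where "q = 5 * \<sigma> / (8 * lam * (norm ?y)\<^sup>2)"
  have q: "q \<le> 1/4"
  proof -
    have "\<sigma> \<le> 2/5 * (lam * (norm ?y)\<^sup>2)"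
      using \<sigma> mult_strict_right_mono[OF c(1) ly] by linarith
    then show ?thesis
      unfolding q_def using ly by (simp add: pos_divide_le_eq mult.assoc)
  qed
  \<comment> \<open>Near \<open>y\<close> the line search returns 1, so the iteration is the full Newton step estimated in \<open>error\<close>.\<close>
  have near: "\<forall>\<^sub>F z in nhds ?y. \<forall>k\<ge>K. x k = z \<longrightarrow>
      norm (x (Suc k) - ?y) \<le> c1 * (norm (z - ?y))\<^sup>2 + c2 * norm (z - ?y) powr (1 + \<delta>) + q * norm (z - ?y)"
    using accepted error
  proof eventually_elim
    case (elim z)
    show ?case
    proof (intro allI impI)
      fix k assume k: "k \<ge> K" "x k = z"
      have "armijo_step f \<mu>2 \<alpha>2 z (d z) (g z \<bullet> d z) = 1"
        using elim(1) x0[of k] k(2) by (intro armijo_step_unit) auto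
      then have "x (Suc k) = z + d z"
        using phase2[OF k(1)] k(2) by (simp add: phase2_step_eq)
      then show "norm (x (Suc k) - ?y) \<le> c1 * (norm (z - ?y))\<^sup>2
          + c2 * norm (z - ?y) powr (1 + \<delta>) + q * norm (z - ?y)"
        using elim(2) by (simp add: q_def)
    qed
  qed
  have "\<forall>\<^sub>F z in nhds ?y. \<forall>k\<ge>K. x k = z \<longrightarrow> norm (x (Suc k) - ?y) \<le> norm (z - ?y) / 2"
    using near superlinear_term_small[of "1/4" c1 ?y c2, simplified]
  proof eventually_elim
    case (elim z)
    have "q * norm (z - ?y) \<le> 1/4 * norm (z - ?y)"
      by (intro mult_right_mono q) simp
    with elim show ?case by fastforce
  qed
  then obtain r where r: "0 < r" "\<And>k. k \<ge> K \<Longrightarrow> norm (x k - ?y) < r \<Longrightarrow> norm (x (Suc k) - ?y) \<le> norm (x k - ?y) / 2"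
    unfolding eventually_nhds_metric dist_norm by blast
  have lim: "x \<longlonglongrightarrow> ?y"
    by (rule contraction_capture[OF assms(17) r])
  then have "\<forall>\<^sub>F k in sequentially. \<forall>l\<ge>K. x l = x k \<longrightarrow> norm (x (Suc l) - ?y)
      \<le> c1 * (norm (x k - ?y))\<^sup>2 + c2 * norm (x k - ?y) powr (1 + \<delta>) + q * norm (x k - ?y)"
    using near unfolding filterlim_iff by blast
  with eventually_ge_at_top[of K]
  have rate: "\<forall>\<^sub>F k in sequentially. norm (x (Suc k) - ?y)
      \<le> c1 * (norm (x k - ?y))\<^sup>2 + c2 * norm (x k - ?y) powr (1 + \<delta>) + q * norm (x k - ?y)"
    by eventually_elim blast
  then have "\<forall>\<^sub>F k in sequentially. norm (x (Suc k) - ?y)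
      \<le> c1 * (norm (x k - ?y))\<^sup>2 + c2 * norm (x k - ?y) powr (1 + \<delta>) + 1/4 * norm (x k - ?y)"
  proof eventually_elim
    case (elim k)
    have "q * norm (x k - ?y) \<le> 1/4 * norm (x k - ?y)"
      by (intro mult_right_mono q) simp
    with elim show ?case by linarith
  qed
  then obtain N where N: "\<And>k. k \<ge> N \<Longrightarrow> norm (x (Suc k) - ?y)
      \<le> c1 * (norm (x k - ?y))\<^sup>2 + c2 * norm (x k - ?y) powr (1 + \<delta>) + 1/4 * norm (x k - ?y)"
    unfolding eventually_sequentially by blast
  have "converges_with_rate x ?y (1 + \<delta>)" if res: "\<forall>i\<in>{1..n}. residual A b i ?y = 0"
    unfolding converges_with_rate_def
  proof (intro conjI exI)
    show "x \<longlonglongrightarrow> ?y" by (rule lim)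
    have "B ?y = 0" using res by (simp add: residual_matrix_def)
    then have q0: "q = 0" by (simp add: q_def \<sigma>_def spectral_norm_def onorm_zero)
    have "\<forall>\<^sub>F k in sequentially. norm (x k - ?y) < 1"
      using tendstoD[OF lim, of 1] by (simp add: dist_norm)
    with rate show "\<forall>\<^sub>F k in sequentially. norm (x (Suc k) - ?y) \<le> (c1 + c2) * norm (x k - ?y) powr (1 + \<delta>)"
    proof eventually_elim
      case (elim k)
      have "(norm (x k - ?y))\<^sup>2 \<le> norm (x k - ?y) powr (1 + \<delta>)"
      proof (cases "x k = ?y")
        case False
        then have "norm (x k - ?y) powr 2 \<le> norm (x k - ?y) powr (1 + \<delta>)"
          using elim(2) \<delta> by (intro powr_mono') auto
        then show ?thesis using False by simp
      qed simp
      then have "c1 * (norm (x k - ?y))\<^sup>2 \<le> c1 * norm (x k - ?y) powr (1 + \<delta>)"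
        using c12 by (intro mult_left_mono) auto
      with elim(1) show ?case by (simp add: q0 distrib_right)
    qed
  qed
  moreover have "\<exists>c1>0. \<exists>c2>0. \<exists>c3. 0 < c3 \<and> c3 < 1/2 \<and> (\<exists>N. \<forall>k\<ge>N. k > K \<longrightarrow> norm (x (Suc k) - ?y)
      \<le> c1 * (norm (x k - ?y))\<^sup>2 + c2 * norm (x k - ?y) powr (1 + \<delta>) + c3 * norm (x k - ?y))"
    using N c12 by (intro exI[of _ c1] exI[of _ c2] exI[of _ "1/4"] conjI exI[of _ N]) auto
  ultimately show ?thesis using K by blast
qed

end
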